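(* Let $f$ be the subcritical random multiplicative cascade function generated by $W$. If $E\subset[0,1]$ is non-empty and compact and $d_E=\dim_{\mathrm P}E$, then almost surely $\dim_{\mathrm P}f(E)\leq s$, where $s\in[0,1]$ satisfies $$2^{d_E}=\frac{2^s}{\mathbb{E}(W^s)}.$$
   Context: $\dim_{\mathrm P}$ denotes packing dimension. Random cascade. $W$ is a positive random variable, not almost surely constant, with $\mathbb{E}(W)=1$ and $\mathbb{E}(W\log_2 W)<1$ (subcritical). Let $\{W_{\mathbf i}\}$, indexed by non-empty finite words $\mathbf i$ over $\{0,1\}$, be independent random variables with the distribution of $W$. For $\mathbf i=i_1\dots i_k\in\{0,1\}^k$ ($k\ge0$) let $I_{\mathbf i}=\big[\sum_{j=1}^k2^{-j}i_j,\ \sum_{j=1}^k2^{-j}i_j+2^{-k}\big)$ be the corresponding dyadic interval (the rightmost one being taken closed). Let $\mu$ be the random measure on $[0,1]$ with $\mu(I_{\mathbf i})=2^{-k}W_{i_1}W_{i_1i_2}\cdots W_{i_1\dots i_k}L_{\mathbf i}$, where $L_{\mathbf i}=\lim_{n\to\infty}\sum_{\mathbf j\in\{0,1\}^n}2^{-n}W_{\mathbf i j_1}\cdots W_{\mathbf i j_1\dots j_n}$ (almost sure limit; words are combined by juxtaposition). The multiplicative cascade function is $f:[0,1]\to[0,\infty)$, $f(x)=\mu([0,x))$, which is almost surely strictly increasing and continuous. The function $s\mapsto 2^s/\mathbb{E}(W^s)$ is continuous and strictly increasing from $[0,1]$ onto $[1,2]$. *)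

theory Defs
  imports "HOL-Probability.Probability"
begin

section \<open>Packing dimension\<close>

text \<open>A packing of \<open>E\<close> by closed balls is encoded as a set of (centre, radius) pairs, so
  that the centre and radius of a ball need not be recovered from the ball as a set.\<close>

definition ball_packing :: "real \<Rightarrow> 'a::metric_space set \<Rightarrow> ('a \<times> real) set \<Rightarrow> bool" where
  "ball_packing \<delta> E B \<longleftrightarrow>
     countable B \<and> B \<subseteq> E \<times> {0<..\<delta>} \<and> disjoint_family_on (\<lambda>(x, r). cball x r) B"

definition packing_premeasure_scale :: "real \<Rightarrow> real \<Rightarrow> 'a::metric_space set \<Rightarrow> ennreal" where
  "packing_premeasure_scale s \<delta> E =
     (SUP B\<in>{B. ball_packing \<delta> E B}. \<Sum>\<^sub>\<infinity>(x, r)\<in>B. ennreal ((2 * r) powr s))"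

text \<open>The quantity above is monotone in \<open>\<delta>\<close>, so the infimum is the limit as \<open>\<delta>\<close> tends to 0.\<close>

definition packing_premeasure :: "real \<Rightarrow> 'a::metric_space set \<Rightarrow> ennreal" where
  "packing_premeasure s E = (INF \<delta>\<in>{0<..}. packing_premeasure_scale s \<delta> E)"

text \<open>The premeasure is not countably subadditive; the packing measure is obtained from it by
  taking the infimum over countable covers.\<close>

definition packing_measure :: "real \<Rightarrow> 'a::metric_space set \<Rightarrow> ennreal" where
  "packing_measure s E =
     (INF F\<in>{F :: nat \<Rightarrow> 'a set. E \<subseteq> (\<Union>i. F i)}. \<Sum>i. packing_premeasure s (F i))"

definition packing_dim :: "'a::metric_space set \<Rightarrow> ereal" where
  "packing_dim E = (INF s\<in>{s. 0 \<le> s \<and> packing_measure s E = 0}. ereal s)"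

section \<open>Multiplicative cascades\<close>

text \<open>Words over \<open>{0,1}\<close> are boolean lists, with \<open>True\<close> for the digit 1.\<close>

definition dyadic_left :: "bool list \<Rightarrow> real" where
  "dyadic_left w = (\<Sum>j<length w. of_bool (w ! j) / 2 ^ Suc j)"

definition dyadic_interval :: "bool list \<Rightarrow> real set" where
  "dyadic_interval w =
     (let a = dyadic_left w; b = a + 1 / 2 ^ length w
      in if b = 1 then {a..b} else {a..<b})"

text \<open>In the following, \<open>X\<close> is one realisation of the weights; its value at the empty word is
  never used.\<close>

definition cascade_partial :: "(bool list \<Rightarrow> real) \<Rightarrow> bool list \<Rightarrow> nat \<Rightarrow> real" where
  "cascade_partial X w n =
     (\<Sum>v | length v = n. 1 / 2 ^ n * (\<Prod>k=1..n. X (w @ take k v)))"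

text \<open>Convergence is stated explicitly because \<open>lim\<close> is an unspecified value for divergent
  sequences; for a subcritical random cascade it holds almost surely.\<close>

definition is_cascade_measure :: "(bool list \<Rightarrow> real) \<Rightarrow> real measure \<Rightarrow> bool" where
  "is_cascade_measure X \<mu> \<longleftrightarrow>
     sets \<mu> = sets (restrict_space borel {0..1}) \<and>
     (\<forall>w. convergent (cascade_partial X w) \<and>
        emeasure \<mu> (dyadic_interval w) =
          ennreal (1 / 2 ^ length w * (\<Prod>k=1..length w. X (take k w)) * lim (cascade_partial X w)))"

definition cascade_function :: "real measure \<Rightarrow> real \<Rightarrow> real" where
  "cascade_function \<mu> x = measure \<mu> {0..<x}"

end

theory Submission
  imports Defs
begin

text \<open>Each piece \<open>F\<close> of a suitable countable cover of \<open>E\<close> meets at most \<open>C 2\<^sup>n\<^sup>t\<close> dyadic intervals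
  of length \<open>2\<^sup>-\<^sup>n\<close>, with \<open>t\<close> close to \<open>d\<^sub>E\<close>. A packing sum of \<open>f(F)\<close> of exponent \<open>s'\<close> is dominated by
  the sum of \<open>\<mu>(I) powr s'\<close> over small dyadic intervals \<open>I\<close> close to \<open>F\<close>, whose part at level \<open>n\<close> has
  expectation at most a constant times \<open>(2 powr t \<cdot> 2 powr (-s') \<cdot> E(W powr s'))\<^sup>n\<close>. As
  \<open>s \<mapsto> 2 powr s / E(W powr s)\<close> is strictly increasing on \<open>[0,1]\<close>, this is summable for every
  \<open>s' > s\<close>, so almost surely the packing premeasures of all images \<open>f(F)\<close> vanish.\<close>

section \<open>Packing premeasure and packing dimension\<close>

text \<open>The packing premeasure is not countably subadditive, so a bound on the packing dimension
  controls dyadic counts only piece by piece, each piece with its own constant. The pieces are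
  chosen from \<open>E\<close> alone and are therefore deterministic, which is what allows the
  expected sums to be evaluated term by term. On the image side the scale is random: how deep a
  dyadic interval must lie to have mass at most r depends on the realisation. Summing over all deep
  levels at once removes this dependence. Masses are limits, and \<mu> carries no measurability
  assumption in \<omega>, so expectations are taken of truncated masses and Fatou's lemma gives the
  passage to the limit. Every exponent s' > s and every piece costs a null set, hence only countably
  many of each are used.\<close>

lemma ball_packing_disjointD:
  assumes "ball_packing \<delta> A B" "(x, r) \<in> B" "(y, t) \<in> B" "z \<in> cball x r" "z \<in> cball y t"
  shows "(x, r) = (y, t)"
proof (rule ccontr)
  assume "(x, r) \<noteq> (y, t)"
  moreover have "\<forall>m\<in>B. \<forall>n\<in>B. m \<noteq> n \<longrightarrow> (\<lambda>(x, r). cball x r) m \<inter> (\<lambda>(x, r). cball x r) n = {}"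
    using assms(1) unfolding ball_packing_def disjoint_family_on_def by blast
  ultimately have "(\<lambda>(x, r). cball x r) (x, r) \<inter> (\<lambda>(x, r). cball x r) (y, t) = {}"
    using assms(2,3) by blast
  then have "cball x r \<inter> cball y t = {}" by simp
  with assms(4,5) show False by blast
qed

lemma ball_packing_subset:
  assumes "ball_packing \<delta> A B" "H \<subseteq> B"
  shows "ball_packing \<delta> A H"
proof -
  have "countable H"
    using assms unfolding ball_packing_def by (meson countable_subset)
  moreover have "H \<subseteq> A \<times> {0<..\<delta>}"
    using assms unfolding ball_packing_def by (meson subset_trans)
  moreover have "disjoint_family_on (\<lambda>(x, r). cball x r) H"
    using assms unfolding ball_packing_def by (metis disjoint_family_on_mono)
  ultimately show ?thesis unfolding ball_packing_def by blast
qed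

text \<open>A sum in \<open>ennreal\<close> is the supremum of its finite partial sums, and a
  subfamily of a packing is a packing. From here on all packings are finite and all sums
  real.\<close>

lemma packing_premeasure_scale_le:
  assumes "\<And>H. finite H \<Longrightarrow> ball_packing \<delta> A H \<Longrightarrow> (\<Sum>(x, r)\<in>H. (2 * r) powr s) \<le> e"
  shows "packing_premeasure_scale s \<delta> A \<le> ennreal e"
  unfolding packing_premeasure_scale_def
proof (rule SUP_least)
  fix B assume "B \<in> {B. ball_packing \<delta> A B}"
  then have B: "ball_packing \<delta> A B" by simp
  have "(\<Sum>\<^sub>\<infinity>(x, r)\<in>B. ennreal ((2 * r) powr s))
      = (SUP H\<in>{H. finite H \<and> H \<subseteq> B}. \<Sum>(x, r)\<in>H. ennreal ((2 * r) powr s))"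
    by (rule nonneg_infsum_complete) auto
  also have "\<dots> \<le> ennreal e"
  proof (rule SUP_least)
    fix H assume "H \<in> {H. finite H \<and> H \<subseteq> B}"
    then have "finite H" "ball_packing \<delta> A H"
      using B ball_packing_subset by auto
    then show "(\<Sum>(x, r)\<in>H. ennreal ((2 * r) powr s)) \<le> ennreal e"
      using assms[of H] by (simp add: case_prod_unfold sum_ennreal ennreal_leI)
  qed
  finally show "(\<Sum>\<^sub>\<infinity>(x, r)\<in>B. ennreal ((2 * r) powr s)) \<le> ennreal e" .
qed

lemma packing_sum_le_scale:
  assumes "finite B" "ball_packing \<delta> A B"
  shows "ennreal (\<Sum>(x, r)\<in>B. (2 * r) powr s) \<le> packing_premeasure_scale s \<delta> A"
proof -
  have "ennreal (\<Sum>(x, r)\<in>B. (2 * r) powr s) = (\<Sum>\<^sub>\<infinity>(x, r)\<in>B. ennreal ((2 * r) powr s))"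
    using assms(1) by (simp add: case_prod_unfold sum_ennreal)
  also have "\<dots> \<le> packing_premeasure_scale s \<delta> A"
    unfolding packing_premeasure_scale_def using assms(2) by (intro SUP_upper2[where i = B]) auto
  finally show ?thesis .
qed

lemma packing_premeasure_eq_0I:
  assumes "\<And>e. e > 0 \<Longrightarrow> \<exists>\<delta>>0. \<forall>H. finite H \<and> ball_packing \<delta> A H \<longrightarrow>
             (\<Sum>(x, r)\<in>H. (2 * r) powr s) \<le> e"
  shows "packing_premeasure s A = 0"
proof -
  have "packing_premeasure s A \<le> 0 + ennreal e" if e: "e > 0" for e
  proof -
    obtain \<delta> where \<delta>: "\<delta> > 0"
      "\<And>H. finite H \<Longrightarrow> ball_packing \<delta> A H \<Longrightarrow> (\<Sum>(x, r)\<in>H. (2 * r) powr s) \<le> e"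
      using assms[OF e] by blast
    have "packing_premeasure s A \<le> packing_premeasure_scale s \<delta> A"
      unfolding packing_premeasure_def using \<delta>(1) by (intro INF_lower2[where i = \<delta>]) auto
    also have "\<dots> \<le> ennreal e"
      using \<delta>(2) by (intro packing_premeasure_scale_le) auto
    finally show ?thesis by simp
  qed
  then have "packing_premeasure s A \<le> 0"
    using ennreal_le_epsilon[of 0 "packing_premeasure s A"] by simp
  then show ?thesis by simp
qed

lemma packing_measure_eq_0I:
  fixes F :: "nat \<Rightarrow> 'a::metric_space set"
  assumes "A \<subseteq> (\<Union>i. F i)" "\<And>i. packing_premeasure s (F i) = 0"
  shows "packing_measure s A = 0"
proof -
  have "packing_measure s A \<le> (\<Sum>i. packing_premeasure s (F i))"
    unfolding packing_measure_def using assms(1) by (intro INF_lower2[where i = F]) auto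
  then show ?thesis
    using assms(2) by simp
qed

lemma packing_dim_le: "0 \<le> s \<Longrightarrow> packing_measure s A = 0 \<Longrightarrow> packing_dim A \<le> ereal s"
  unfolding packing_dim_def by (intro INF_lower2[where i = s]) auto

lemma packing_dim_nonneg: "0 \<le> packing_dim A"
  unfolding packing_dim_def by (intro INF_greatest) simp

text \<open>A cover of total premeasure below 1 has every piece below 1, and the infimum over the
  scale is then below 1 at some \<delta>. The value 1 is only a normalisation; what matters is a
  finite bound at a fixed scale.\<close>

lemma packing_measure_eq_0_cover:
  fixes A :: "'a::metric_space set"
  assumes "packing_measure t A = 0"
  obtains F :: "nat \<Rightarrow> 'a set" where "A \<subseteq> (\<Union>i. F i)"
    "\<And>i. \<exists>\<delta>>0. \<forall>B. finite B \<and> ball_packing \<delta> (F i) B \<longrightarrow> (\<Sum>(x, r)\<in>B. (2 * r) powr t) < 1"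
proof -
  have "packing_measure t A < 1"
    using assms by simp
  then obtain F where F: "A \<subseteq> (\<Union>i. F i)" "(\<Sum>i. packing_premeasure t (F i)) < 1"
    unfolding packing_measure_def by (auto simp: INF_less_iff)
  have "\<exists>\<delta>>0. \<forall>B. finite B \<and> ball_packing \<delta> (F i) B \<longrightarrow> (\<Sum>(x, r)\<in>B. (2 * r) powr t) < 1" for i
  proof -
    have "packing_premeasure t (F i) \<le> (\<Sum>i. packing_premeasure t (F i))"
      using sum_le_suminf[of "\<lambda>i. packing_premeasure t (F i)" "{i}"] by simp
    then have "packing_premeasure t (F i) < 1"
      using F(2) by simp
    then obtain \<delta> where \<delta>: "\<delta> > 0" "packing_premeasure_scale t \<delta> (F i) < 1"
      unfolding packing_premeasure_def by (auto simp: INF_less_iff)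
    have "(\<Sum>(x, r)\<in>B. (2 * r) powr t) < 1" if "finite B" "ball_packing \<delta> (F i) B" for B
    proof -
      have "ennreal (\<Sum>(x, r)\<in>B. (2 * r) powr t) < ennreal 1"
        using le_less_trans[OF packing_sum_le_scale[OF that] \<delta>(2)] by simp
      then show ?thesis
        by (subst (asm) ennreal_less_iff) (auto intro!: sum_nonneg)
    qed
    then show ?thesis using \<delta>(1) by blast
  qed
  with F(1) show ?thesis by (rule that)
qed

text \<open>Disjoint balls centred in \<open>A\<close> with radius at most \<delta> fit into the
  interval enlarged by \<delta> on both sides; compare Lebesgue measures.\<close>

lemma packing_diameter_sum_le:
  fixes A :: "real set"
  assumes "finite H" "ball_packing \<delta> A H" "A \<subseteq> {a..b}" "a \<le> b" "\<delta> > 0"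
  shows "(\<Sum>(x, r)\<in>H. 2 * r) \<le> b - a + 2 * \<delta>"
proof -
  have r: "0 < r" "r \<le> \<delta>" "a \<le> x" "x \<le> b" if "(x, r) \<in> H" for x r
    using that assms(2,3) unfolding ball_packing_def by auto
  have "ennreal (\<Sum>(x, r)\<in>H. 2 * r) = (\<Sum>(x, r)\<in>H. emeasure lborel (cball x r))"
    using r by (subst sum_ennreal[symmetric])
      (force simp: case_prod_unfold cball_eq_atLeastAtMost intro!: sum.cong)+
  also have "\<dots> = emeasure lborel (\<Union>(x, r)\<in>H. cball x r)"
    using assms(1,2) unfolding ball_packing_def
    by (simp add: case_prod_unfold sum_emeasure image_subset_iff)
  also have "\<dots> \<le> emeasure lborel {a - \<delta>..b + \<delta>}"
  proof (rule emeasure_mono)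
    show "(\<Union>(x, r)\<in>H. cball x r) \<subseteq> {a - \<delta>..b + \<delta>}"
      using r by (fastforce simp: cball_eq_atLeastAtMost)
  qed simp
  also have "\<dots> = ennreal (b - a + 2 * \<delta>)"
    using assms(4,5) by simp
  finally show ?thesis
    using assms(4,5) by (subst (asm) ennreal_le_iff) auto
qed

text \<open>Split off one power of the diameter: these powers add up to a bounded total length,
  while the remaining factor is at most \<open>(2 * \<delta>) powr (t - 1)\<close>, which tends to
  0. Hence already the premeasure vanishes and the constant cover suffices.\<close>

lemma packing_measure_bounded_real_eq_0:
  fixes A :: "real set"
  assumes "bounded A" "t > 1"
  shows "packing_measure t A = 0"
proof (rule packing_measure_eq_0I[where F = "\<lambda>_. A"])
  obtain a where a: "a > 0" "A \<subseteq> {-a..a}"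
    using assms(1) by (auto simp: bounded_pos subset_iff abs_le_iff) (metis minus_le_iff)
  have "packing_premeasure t A = 0"
  proof (rule packing_premeasure_eq_0I)
    fix e :: real assume "e > 0"
    have "((\<lambda>\<delta>. (2 * \<delta>) powr (t - 1) * (2 * a + 2 * \<delta>)) \<longlongrightarrow> (2 * 0) powr (t - 1) * (2 * a + 2 * 0)) (at_right 0)"
      using assms(2) by (intro tendsto_intros) (auto intro: eventually_at_rightI[of 0 1])
    then have "((\<lambda>\<delta>. (2 * \<delta>) powr (t - 1) * (2 * a + 2 * \<delta>)) \<longlongrightarrow> 0) (at_right 0)"
      by simp
    then have "eventually (\<lambda>\<delta>. (2 * \<delta>) powr (t - 1) * (2 * a + 2 * \<delta>) < e) (at_right 0)"
      using \<open>e > 0\<close> by (rule order_tendstoD)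
    then have "eventually (\<lambda>\<delta>. (2 * \<delta>) powr (t - 1) * (2 * a + 2 * \<delta>) < e \<and> \<delta> > 0) (at_right 0)"
      by (intro eventually_conj eventually_at_right_less)
    then obtain \<delta> :: real where \<delta>: "(2 * \<delta>) powr (t - 1) * (2 * a + 2 * \<delta>) < e" "\<delta> > 0"
      using eventually_happens'[OF trivial_limit_at_right_real] by blast
    have "(\<Sum>(x, r)\<in>H. (2 * r) powr t) \<le> e" if H: "finite H" "ball_packing \<delta> A H" for H
    proof -
      have "(\<Sum>(x, r)\<in>H. (2 * r) powr t) \<le> (\<Sum>(x, r)\<in>H. (2 * \<delta>) powr (t - 1) * (2 * r))"
      proof (rule sum_mono, clarify)
        fix x r assume "(x, r) \<in> H"
        then have r: "0 < r" "r \<le> \<delta>"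
          using H(2) unfolding ball_packing_def by auto
        have "(2 * r) powr t = (2 * r) powr (t - 1) * (2 * r)"
          using r by (simp add: powr_diff)
        also have "\<dots> \<le> (2 * \<delta>) powr (t - 1) * (2 * r)"
          using r assms(2) by (intro mult_right_mono powr_mono2) auto
        finally show "(2 * r) powr t \<le> (2 * \<delta>) powr (t - 1) * (2 * r)" .
      qed
      also have "\<dots> = (2 * \<delta>) powr (t - 1) * (\<Sum>(x, r)\<in>H. 2 * r)"
        by (simp add: case_prod_unfold sum_distrib_left)
      also have "\<dots> \<le> (2 * \<delta>) powr (t - 1) * (2 * a + 2 * \<delta>)"
        using packing_diameter_sum_le[OF H a(2)] a(1) \<delta>(2) by (intro mult_left_mono) auto
      finally show ?thesis using \<delta>(1) by simp
    qed
    then show "\<exists>\<delta>>0. \<forall>H. finite H \<and> ball_packing \<delta> A H \<longrightarrow> (\<Sum>(x, r)\<in>H. (2 * r) powr t) \<le> e"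
      using \<delta>(2) by blast
  qed
  then show "packing_premeasure t A = 0" for i :: nat .
qed simp

text \<open>Serves twice: for the image it settles the endpoint s = 1, and for \<open>E\<close> it
  makes the dimension finite, so that \<open>real_of_ereal\<close> loses nothing.\<close>

lemma packing_dim_bounded_real_le:
  fixes A :: "real set"
  assumes "bounded A"
  shows "packing_dim A \<le> 1"
proof (rule ereal_le_epsilon2)
  fix e :: real assume "e > 0"
  then have "packing_dim A \<le> ereal (1 + e)"
    using assms by (intro packing_dim_le packing_measure_bounded_real_eq_0) auto
  then show "packing_dim A \<le> 1 + ereal e"
    by (simp add: one_ereal_def)
qed

section \<open>Dyadic intervals\<close>

lemma dyadic_left_Nil [simp]: "dyadic_left [] = 0"
  by (simp add: dyadic_left_def)

lemma dyadic_left_Cons: "dyadic_left (b # w) = (of_bool b + dyadic_left w) / 2"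
  by (simp add: dyadic_left_def sum.lessThan_Suc_shift sum_divide_distrib add_divide_distrib
      del: sum.lessThan_Suc)

lemma dyadic_left_snoc: "dyadic_left (w @ [b]) = dyadic_left w + of_bool b / 2 ^ Suc (length w)"
  by (induction w) (simp_all add: dyadic_left_Cons field_simps)

lemma dyadic_left_bounds: "0 \<le> dyadic_left w" "dyadic_left w + 1 / 2 ^ length w \<le> 1"
proof (induction w)
  case (Cons b w)
  case 1
  show ?case using Cons by (simp add: dyadic_left_Cons)
  case 2
  have "dyadic_left (b # w) + 1 / 2 ^ length (b # w)
      = (of_bool b + (dyadic_left w + 1 / 2 ^ length w)) / 2"
    by (simp add: dyadic_left_Cons add_divide_distrib)
  also have "\<dots> \<le> (1 + 1) / 2"
    using Cons by (intro divide_right_mono add_mono) auto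
  finally show ?case by simp
qed simp_all

text \<open>Induction on the first digit: equal first digits halve the gap of the tails, different
  ones put the two intervals into different halves of [0,1].\<close>

lemma dyadic_left_separated:
  assumes "length v = length w" "v \<noteq> w"
  shows "1 / 2 ^ length w \<le> \<bar>dyadic_left v - dyadic_left w\<bar>"
  using assms
proof (induction v w rule: list_induct2)
  case (Cons a v b w)
  note bv = dyadic_left_bounds[of v] and bw = dyadic_left_bounds[of w]
  have l: "length v = length w" using Cons by simp
  show ?case
  proof (cases "a = b")
    case True
    then have "dyadic_left (a # v) - dyadic_left (b # w) = (dyadic_left v - dyadic_left w) / 2"
      by (simp add: dyadic_left_Cons diff_divide_distrib add_divide_distrib)
    moreover have "1 / 2 ^ length w \<le> \<bar>dyadic_left v - dyadic_left w\<bar>"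
      using Cons True by blast
    ultimately show ?thesis by (simp add: abs_divide)
  next
    case False
    define h :: real where "h = 1 / 2 ^ length w"
    have h: "0 \<le> dyadic_left v" "dyadic_left v + h \<le> 1" "0 \<le> dyadic_left w" "dyadic_left w + h \<le> 1"
      using bv bw l by (simp_all add: h_def)
    have arith: "h / 2 \<le> \<bar>(1 + p) / 2 - q / 2\<bar>" if "0 \<le> p" "q + h \<le> 1" for p q :: real
      using that by (simp add: field_simps)
    have "h / 2 \<le> \<bar>(of_bool a + dyadic_left v) / 2 - (of_bool b + dyadic_left w) / 2\<bar>"
    proof (cases a)
      case True
      then show ?thesis
        using arith[of "dyadic_left v" "dyadic_left w"] h False by simp
    next
      case nota: False
      then show ?thesis
        using arith[of "dyadic_left w" "dyadic_left v"] h False by (simp add: abs_minus_commute)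
    qed
    then show ?thesis
      by (simp add: dyadic_left_Cons h_def)
  qed
qed simp

lemma dyadic_interval_bounds:
  assumes "x \<in> dyadic_interval w"
  shows "dyadic_left w \<le> x" "x \<le> dyadic_left w + 1 / 2 ^ length w" "0 \<le> x" "x \<le> 1"
  using assms dyadic_left_bounds[of w]
  by (auto simp: dyadic_interval_def Let_def split: if_splits)

lemma dyadic_interval_snoc:
  "dyadic_interval w = dyadic_interval (w @ [False]) \<union> dyadic_interval (w @ [True])"
proof -
  define h :: real where "h = 1 / 2 ^ Suc (length w)"
  have h: "h > 0" "1 / 2 ^ length w = 2 * h"
    by (simp_all add: h_def)
  have "dyadic_left w + 2 * h \<le> 1"
    using dyadic_left_bounds(2)[of w] h by simp
  \<comment> \<open>The left child never ends at 1, so it is always half-open; a closed right end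
    passes to the right child only.\<close>
  then have "dyadic_left w + h < 1"
    using h(1) by linarith
  then have "dyadic_interval (w @ [False]) = {dyadic_left w..<dyadic_left w + h}"
    by (simp add: dyadic_interval_def dyadic_left_snoc h_def Let_def)
  moreover have "dyadic_interval (w @ [True]) =
      (if dyadic_left w + 2 * h = 1 then {dyadic_left w + h..dyadic_left w + 2 * h}
       else {dyadic_left w + h..<dyadic_left w + 2 * h})"
  proof -
    have "dyadic_left (w @ [True]) = dyadic_left w + h" "1 / 2 ^ length (w @ [True]) = h"
      by (simp_all add: dyadic_left_snoc h_def)
    then show ?thesis
      unfolding dyadic_interval_def Let_def by (simp only: add.assoc mult_2)
  qed
  moreover have "dyadic_interval w =
      (if dyadic_left w + 2 * h = 1 then {dyadic_left w..dyadic_left w + 2 * h}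
       else {dyadic_left w..<dyadic_left w + 2 * h})"
    unfolding dyadic_interval_def Let_def h(2) ..
  ultimately show ?thesis
    using h(1) by (auto split: if_splits)
qed

lemma dyadic_interval_butlast: "w \<noteq> [] \<Longrightarrow> dyadic_interval w \<subseteq> dyadic_interval (butlast w)"
  using dyadic_interval_snoc[of "butlast w"] append_butlast_last_id[of w]
  by (cases "last w") auto

lemma dyadic_interval_Nil: "dyadic_interval [] = {0..1}"
  by (simp add: dyadic_interval_def)

lemma dyadic_interval_exists:
  assumes "x \<in> {0..1}"
  shows "\<exists>w. length w = n \<and> x \<in> dyadic_interval w"
proof (induction n)
  case 0
  then show ?case using assms by (simp add: dyadic_interval_Nil)
next
  case (Suc n)
  then obtain w where "length w = n" "x \<in> dyadic_interval w" by blast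
  then show ?case
    using dyadic_interval_snoc[of w] by (auto intro: exI[of _ "w @ [True]"] exI[of _ "w @ [False]"])
qed

text \<open>Sharing the last digit keeps the two intervals on the same side of distinct parents, hence
  at least one interval length apart.\<close>

lemma dyadic_interval_separated:
  assumes "length v = Suc n" "length w = Suc n" "v \<noteq> w" "last v = last w"
    and "x \<in> dyadic_interval v" "y \<in> dyadic_interval w"
  shows "1 / 2 ^ Suc n \<le> \<bar>x - y\<bar>"
proof -
  obtain v' w' b where vw: "v = v' @ [b]" "w = w' @ [b]"
    using assms(1,2,4) by (cases v rule: rev_cases; cases w rule: rev_cases) auto
  then have "v' \<noteq> w'" "length v' = n" "length w' = n"
    using assms by auto
  then have "1 / 2 ^ n \<le> \<bar>dyadic_left v' - dyadic_left w'\<bar>"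
    using dyadic_left_separated[of v' w'] by simp
  also have "\<dots> = \<bar>dyadic_left v - dyadic_left w\<bar>"
    using vw \<open>length v' = n\<close> \<open>length w' = n\<close> by (simp add: dyadic_left_snoc)
  finally have 1: "1 / 2 ^ n \<le> \<bar>dyadic_left v - dyadic_left w\<bar>" .
  define h :: real where "h = 1 / 2 ^ Suc n"
  have "2 * h \<le> \<bar>dyadic_left v - dyadic_left w\<bar>"
    using 1 by (simp add: h_def)
  moreover have "dyadic_left v \<le> x" "x \<le> dyadic_left v + h" "dyadic_left w \<le> y" "y \<le> dyadic_left w + h"
    using dyadic_interval_bounds(1,2)[OF assms(5)] dyadic_interval_bounds(1,2)[OF assms(6)]
    unfolding assms(1,2) h_def by auto
  ultimately have "h \<le> \<bar>x - y\<bar>"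
    by linarith
  then show ?thesis by (simp only: h_def)
qed

section \<open>Dyadic box counting\<close>

definition meeting_words :: "real set \<Rightarrow> nat \<Rightarrow> bool list set" where
  "meeting_words F n = {w. length w = n \<and> dyadic_interval w \<inter> F \<noteq> {}}"

lemma finite_words: "finite {w :: bool list. length w = n}"
  using finite_lists_length_eq[of "UNIV :: bool set" n] by simp

lemma card_words: "card {w :: bool list. length w = n} = 2 ^ n"
  using card_lists_length_eq[of "UNIV :: bool set" n] by simp

lemma finite_meeting_words [simp]: "finite (meeting_words F n)"
  by (rule finite_subset[OF _ finite_words[of n]]) (auto simp: meeting_words_def)

text \<open>One point of \<open>F\<close> is chosen in each interval and made the centre of a ball.
  Points from adjacent intervals may be arbitrarily close, so the words are split by their last
  digit; the factor 2 counts the two classes.\<close>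

lemma card_meeting_words_le_packing:
  assumes pack: "\<And>B. finite B \<Longrightarrow> ball_packing \<delta> F B \<Longrightarrow> (\<Sum>(x, r)\<in>B. (2 * r) powr t) < 1"
    and n: "1 / 2 ^ Suc (Suc (Suc n)) \<le> \<delta>"
  shows "real (card (meeting_words F (Suc n))) \<le> 2 * 2 powr (real (Suc (Suc n)) * t)"
proof -
  \<comment> \<open>Points of one class are at least \<open>1 / 2 ^ Suc n\<close> apart. This radius
    makes \<open>2 * r\<close> half of that, so the closed balls are disjoint rather than possibly
    touching.\<close>
  define r :: real where "r = 1 / 2 ^ Suc (Suc (Suc n))"
  have cls: "real (card {w \<in> meeting_words F (Suc n). last w = b}) \<le> 2 powr (real (Suc (Suc n)) * t)"
    (is "real (card ?V) \<le> _") for b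
  proof -
    have "\<forall>w\<in>?V. \<exists>x. x \<in> dyadic_interval w \<and> x \<in> F"
      by (auto simp: meeting_words_def)
    then obtain p where p: "\<And>w. w \<in> ?V \<Longrightarrow> p w \<in> dyadic_interval w \<and> p w \<in> F"
      by metis
    have r: "0 < r" "r \<le> \<delta>" "2 * r < 1 / 2 ^ Suc n"
      using n by (auto simp: r_def field_simps)
    have sep: "2 * r < \<bar>p v - p w\<bar>" if "v \<in> ?V" "w \<in> ?V" "v \<noteq> w" for v w
      using dyadic_interval_separated[of v n w "p v" "p w"] that p[of v] p[of w] r(3)
      by (auto simp: meeting_words_def)
    have inj: "inj_on (\<lambda>w. (p w, r)) ?V"
      using sep r(1) by (fastforce simp: inj_on_def)
    have "ball_packing \<delta> F ((\<lambda>w. (p w, r)) ` ?V)"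
      unfolding ball_packing_def
    proof (intro conjI)
      show "countable ((\<lambda>w. (p w, r)) ` ?V)"
        by (intro countable_finite) simp
      show "(\<lambda>w. (p w, r)) ` ?V \<subseteq> F \<times> {0<..\<delta>}"
        using p r(1,2) by auto
      show "disjoint_family_on (\<lambda>(x, r). cball x r) ((\<lambda>w. (p w, r)) ` ?V)"
        unfolding disjoint_family_on_def
      proof (intro ballI impI)
        fix c c' assume c: "c \<in> (\<lambda>w. (p w, r)) ` ?V" "c' \<in> (\<lambda>w. (p w, r)) ` ?V" "c \<noteq> c'"
        obtain v where v: "v \<in> ?V" "c = (p v, r)" using c(1) by (rule imageE)
        obtain w where w: "w \<in> ?V" "c' = (p w, r)" using c(2) by (rule imageE)
        have "v \<noteq> w" using v(2) w(2) c(3) by blast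
        then have "2 * r < \<bar>p v - p w\<bar>" using sep v(1) w(1) by blast
        then have "cball (p v) r \<inter> cball (p w) r = {}"
          by (auto simp: cball_eq_atLeastAtMost)
        then show "(case c of (x, r) \<Rightarrow> cball x r) \<inter> (case c' of (x, r) \<Rightarrow> cball x r) = {}"
          unfolding v(2) w(2) by simp
      qed
    qed
    moreover have "finite ((\<lambda>w. (p w, r)) ` ?V)"
      by (intro finite_imageI finite_subset[OF _ finite_meeting_words[of F "Suc n"]]) blast
    ultimately have "(\<Sum>(x, r)\<in>(\<lambda>w. (p w, r)) ` ?V. (2 * r) powr t) < 1"
      by (rule pack[rotated])
    then have "real (card ?V) * (2 * r) powr t < 1"
      by (simp add: sum.reindex[OF inj])
    moreover have "(2 * r) powr t = inverse (2 powr (real (Suc (Suc n)) * t))"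
    proof -
      have "2 * r = 1 / 2 ^ Suc (Suc n)"
        by (simp add: r_def)
      also have "\<dots> = inverse (2 powr real (Suc (Suc n)))"
        by (subst powr_realpow) (auto simp: inverse_eq_divide)
      finally show ?thesis
        by (simp only: inverse_powr powr_powr)
    qed
    ultimately show ?thesis by (simp only: inverse_eq_divide) (simp add: divide_less_eq)
  qed
  have "meeting_words F (Suc n) = {w \<in> meeting_words F (Suc n). last w = True} \<union>
      {w \<in> meeting_words F (Suc n). last w = False}"
    by auto
  then have "card (meeting_words F (Suc n)) \<le> card {w \<in> meeting_words F (Suc n). last w = True} +
      card {w \<in> meeting_words F (Suc n). last w = False}"
    using card_Un_le[of "{w \<in> meeting_words F (Suc n). last w = True}"
        "{w \<in> meeting_words F (Suc n). last w = False}"] by simp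
  then show ?thesis
    using cls[of True] cls[of False] by linarith
qed

lemma card_meeting_words_growth:
  assumes "\<delta> > 0" "t \<ge> 0"
    and "\<And>B. finite B \<Longrightarrow> ball_packing \<delta> F B \<Longrightarrow> (\<Sum>(x, r)\<in>B. (2 * r) powr t) < 1"
  obtains C where "C > 0" "\<And>n. real (card (meeting_words F (Suc n))) \<le> C * (2 powr t) ^ n"
proof -
  obtain n0 :: nat where n0: "1 / 2 ^ n0 < \<delta>"
    using real_arch_pow_inv[of \<delta> "1/2"] assms(1) by (auto simp: power_divide)
  \<comment> \<open>The first entry comes from the packing bound, valid for n at least
    \<open>n0\<close>; the second is the trivial count of all words on the finitely many coarser
    levels.\<close>
  define C where "C = max (2 * 2 powr (2 * t)) (2 ^ Suc n0)"
  have "real (card (meeting_words F (Suc n))) \<le> C * (2 powr t) ^ n" for n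
  proof (cases "n < n0")
    case True
    have "card (meeting_words F (Suc n)) \<le> 2 ^ Suc n"
      unfolding card_words[symmetric]
      by (rule card_mono[OF finite_words]) (auto simp: meeting_words_def)
    also have "\<dots> \<le> 2 ^ Suc n0"
      using True by (intro power_increasing) auto
    finally have "real (card (meeting_words F (Suc n))) \<le> 2 ^ Suc n0"
      by (metis of_nat_le_iff of_nat_numeral of_nat_power)
    also have "\<dots> \<le> C * 1" by (simp add: C_def)
    also have "\<dots> \<le> C * (2 powr t) ^ n"
    proof (rule mult_left_mono)
      show "1 \<le> (2 powr t) ^ n"
        using assms(2) by (intro one_le_power ge_one_powr_ge_zero) auto
      show "0 \<le> C"
        unfolding C_def by (rule max.coboundedI2) simp
    qed
    finally show ?thesis .
  next
    case False
    have "(1 / 2 ^ Suc (Suc (Suc n)) :: real) \<le> 1 / 2 ^ n0"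
      using False by (intro divide_left_mono power_increasing) auto
    then have "real (card (meeting_words F (Suc n))) \<le> 2 * 2 powr (real (Suc (Suc n)) * t)"
      using n0 assms by (intro card_meeting_words_le_packing[of \<delta>]) auto
    also have "\<dots> = 2 * 2 powr (2 * t) * (2 powr t) ^ n"
      by (simp add: powr_add[symmetric] powr_realpow[symmetric] powr_powr algebra_simps)
    also have "\<dots> \<le> C * (2 powr t) ^ n"
      by (intro mult_right_mono) (auto simp: C_def)
    finally show ?thesis .
  qed
  moreover have "C > 0"
    unfolding C_def by (rule less_max_iff_disj[THEN iffD2]) simp
  ultimately show ?thesis
    using that by blast
qed

section \<open>Packings of cascade images\<close>

lemma dyadic_interval_borel [measurable]: "dyadic_interval w \<in> sets borel"
  by (simp add: dyadic_interval_def Let_def)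

lemma dyadic_interval_subset: "dyadic_interval w \<subseteq> {0..1}"
  using dyadic_interval_bounds(3,4) by auto

lemma cascade_measure_sets:
  assumes "is_cascade_measure X \<mu>" "B \<in> sets borel" "B \<subseteq> {0..1}"
  shows "B \<in> sets \<mu>"
  using assms by (auto simp: is_cascade_measure_def sets_restrict_space)

lemma cascade_measure_finite:
  assumes "is_cascade_measure X \<mu>"
  shows "finite_measure \<mu>"
proof
  have "sets \<mu> = sets (restrict_space borel {0..1})"
    using assms by (simp add: is_cascade_measure_def)
  then have "space \<mu> = dyadic_interval []"
    by (auto dest: sets_eq_imp_space_eq simp: dyadic_interval_Nil space_restrict_space)
  then show "emeasure \<mu> (space \<mu>) \<noteq> \<infinity>"
    using assms by (simp add: is_cascade_measure_def)
qed

text \<open>By additivity the increment of f from x to y is the mass of [x,y), and this half-open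
  piece stays inside any dyadic interval containing both points.\<close>

lemma cascade_function_diff:
  assumes "is_cascade_measure X \<mu>" "x \<in> dyadic_interval w" "y \<in> dyadic_interval w"
  shows "\<bar>cascade_function \<mu> x - cascade_function \<mu> y\<bar> \<le> measure \<mu> (dyadic_interval w)"
  using assms(2,3)
proof (induction x y rule: linorder_wlog)
  case (le x y)
  interpret finite_measure \<mu>
    using assms(1) by (rule cascade_measure_finite)
  have xy: "0 \<le> x" "y \<le> 1"
    using dyadic_interval_bounds(3,4) le by auto
  have sets: "{0..<x} \<in> sets \<mu>" "{x..<y} \<in> sets \<mu>" "dyadic_interval w \<in> sets \<mu>"
    using xy le(1) dyadic_interval_subset[of w]
    by (auto intro!: cascade_measure_sets[OF assms(1)])
  have "{0..<y} = {0..<x} \<union> {x..<y}"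
    using xy le(1) by auto
  then have "measure \<mu> {0..<y} = measure \<mu> {0..<x} + measure \<mu> {x..<y}"
    using finite_measure_Union[OF sets(1,2)] by simp
  moreover have "{x..<y} \<subseteq> dyadic_interval w"
    using le by (auto simp: dyadic_interval_def Let_def split: if_splits)
  then have "measure \<mu> {x..<y} \<le> measure \<mu> (dyadic_interval w)"
    using sets(3) by (rule finite_measure_mono)
  ultimately show ?case
    by (simp add: cascade_function_def)
qed (simp add: abs_minus_commute)

text \<open>Each ball centred at \<open>f x\<close> with radius \<open>r\<close> is charged to the largest dyadic interval
  around \<open>x\<close> of mass at most \<open>r\<close>. Its image lies in the ball, so disjoint balls are charged to
  distinct intervals, while the parent interval has mass more than \<open>r\<close>.\<close>

lemma packing_premeasure_cascade_image:
  assumes cascade: "is_cascade_measure X \<mu>" and F: "F \<subseteq> {0..1}" and s: "s > 0"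
    and summable: "summable (\<lambda>n. \<Sum>w\<in>meeting_words F (Suc n).
                     measure \<mu> (dyadic_interval (butlast w)) powr s)"
  shows "packing_premeasure s (cascade_function \<mu> ` F) = 0"
proof (rule packing_premeasure_eq_0I)
  fix e :: real assume e: "e > 0"
  define m where "m w = measure \<mu> (dyadic_interval w)" for w
  define T where "T n = (\<Sum>w\<in>meeting_words F (Suc n). m (butlast w) powr s)" for n
  \<comment> \<open>Half of \<open>e\<close> is reserved for balls charged to long words. The factor
    \<open>2 powr s\<close> is the price of bounding \<open>(2 * r) powr s\<close> by the mass of
    the parent.\<close>
  define e' where "e' = e / 2 / 2 powr s"
  have T: "summable T"
    unfolding T_def m_def by (rule summable)
  have "e' > 0"
    using e by (simp add: e'_def)
  then obtain N where N: "\<And>K. norm (sum T {N..<K}) < e'"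
    using T by (force simp: summable_Cauchy)
  \<comment> \<open>Short words escape the tail estimate, but there are finitely many and each is
    charged at most once; \<delta> is chosen to make their total contribution less than
    \<open>e / 2\<close>.\<close>
  define S :: "bool list set" where "S = {w. length w \<le> N}"
  have S: "finite S"
    unfolding S_def using finite_lists_length_le[of "UNIV :: bool set" N] by simp
  have "((\<lambda>\<delta>. real (card S) * (2 * \<delta>) powr s) \<longlongrightarrow> real (card S) * (2 * 0) powr s) (at_right 0)"
    using s by (intro tendsto_intros) (auto intro: eventually_at_rightI[of 0 1])
  then have "((\<lambda>\<delta>. real (card S) * (2 * \<delta>) powr s) \<longlongrightarrow> 0) (at_right 0)"
    by simp
  then have "eventually (\<lambda>\<delta>. real (card S) * (2 * \<delta>) powr s < e / 2) (at_right 0)"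
    using e by (intro order_tendstoD(2)) auto
  then have "eventually (\<lambda>\<delta>. real (card S) * (2 * \<delta>) powr s < e / 2 \<and> \<delta> > 0) (at_right 0)"
    by (intro eventually_conj eventually_at_right_less)
  then obtain \<delta> :: real where \<delta>: "real (card S) * (2 * \<delta>) powr s < e / 2" "\<delta> > 0"
    using eventually_happens'[OF trivial_limit_at_right_real] by blast
  \<comment> \<open>Summability forces \<open>T n\<close> to 0, and a single term of
    \<open>T n\<close> is at most the sum, so the intervals around a point of \<open>F\<close> have
    arbitrarily small mass. A charged interval therefore exists for every radius.\<close>
  have small: "\<exists>w. x \<in> dyadic_interval w \<and> m w \<le> r" if "x \<in> F" "r > 0" for x r
  proof -
    have "eventually (\<lambda>n. T n < r powr s) sequentially"
      using summable_LIMSEQ_zero[OF T] that(2) by (intro order_tendstoD(2)) auto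
    then obtain n where n: "T n < r powr s"
      by (auto simp: eventually_sequentially)
    have "x \<in> {0..1}"
      using that(1) F by blast
    then obtain v where v: "length v = Suc n" "x \<in> dyadic_interval v"
      using dyadic_interval_exists by blast
    then have "v \<in> meeting_words F (Suc n)"
      using that(1) by (auto simp: meeting_words_def)
    then have "m (butlast v) powr s \<le> T n"
      unfolding T_def by (intro member_le_sum) auto
    then have "m (butlast v) powr s < r powr s"
      using n by simp
    then have "m (butlast v) < r"
      using powr_mono2[of s r "m (butlast v)"] s that(2) by (cases "m (butlast v) < r") auto
    moreover have "x \<in> dyadic_interval (butlast v)"
      using v dyadic_interval_butlast[of v] by fastforce
    ultimately show ?thesis by (intro exI[of _ "butlast v"]) auto
  qed
  have "(\<Sum>(c, r)\<in>H. (2 * r) powr s) \<le> e"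
    if H: "finite H" "ball_packing \<delta> (cascade_function \<mu> ` F) H" for H
  proof -
    have r: "0 < snd c" "snd c \<le> \<delta>" "fst c \<in> cascade_function \<mu> ` F" if "c \<in> H" for c
      using that H(2) by (auto simp: ball_packing_def)
    define largest where "largest c x w \<longleftrightarrow> x \<in> F \<and> cascade_function \<mu> x = fst c \<and>
        x \<in> dyadic_interval w \<and> m w \<le> snd c \<and>
        (\<forall>v. x \<in> dyadic_interval v \<and> m v \<le> snd c \<longrightarrow> length w \<le> length v)" for c x w
    have "\<exists>x w. largest c x w" if c: "c \<in> H" for c
    proof -
      obtain x where x: "x \<in> F" "cascade_function \<mu> x = fst c"
        using r(3)[OF c] by auto
      obtain w0 where "x \<in> dyadic_interval w0 \<and> m w0 \<le> snd c"
        using small[OF x(1) r(1)[OF c]] by blast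
      then have "\<exists>w. (x \<in> dyadic_interval w \<and> m w \<le> snd c) \<and>
          (\<forall>v. x \<in> dyadic_interval v \<and> m v \<le> snd c \<longrightarrow> length w \<le> length v)"
        by (rule ex_has_least_nat)
      then show ?thesis using x unfolding largest_def by blast
    qed
    then obtain p w where "\<And>c. c \<in> H \<Longrightarrow> largest c (p c) (w c)"
      by metis
    then have pw: "\<And>c. c \<in> H \<Longrightarrow> p c \<in> F" "\<And>c. c \<in> H \<Longrightarrow> cascade_function \<mu> (p c) = fst c"
      "\<And>c. c \<in> H \<Longrightarrow> p c \<in> dyadic_interval (w c)" "\<And>c. c \<in> H \<Longrightarrow> m (w c) \<le> snd c"
      and least: "\<And>c v. c \<in> H \<Longrightarrow> p c \<in> dyadic_interval v \<Longrightarrow> m v \<le> snd c \<Longrightarrow> length (w c) \<le> length v"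
      unfolding largest_def by blast+
    have inj: "inj_on w H"
    proof (rule inj_onI)
      fix c d assume cd: "c \<in> H" "d \<in> H" "w c = w d"
      have "dist (fst d) (fst c) \<le> m (w d)"
        using cascade_function_diff[OF cascade, of "p d" "w d" "p c"] pw cd
        by (metis dist_real_def m_def)
      then have "fst c \<in> cball (fst d) (snd d)"
        using pw(4)[OF cd(2)] by simp
      moreover have "fst c \<in> cball (fst c) (snd c)"
        using r(1)[OF cd(1)] by simp
      ultimately show "c = d"
        using ball_packing_disjointD[OF H(2), of "fst c" "snd c" "fst d" "snd d" "fst c"] cd(1,2)
        by (simp add: prod_eq_iff)
    qed
    define A where "A = {c \<in> H. length (w c) \<le> N}"
    define B where "B = {c \<in> H. N < length (w c)}"
    have split: "H = A \<union> B" "A \<inter> B = {}" "finite A" "finite B" "A \<subseteq> H" "B \<subseteq> H"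
      using H(1) by (auto simp: A_def B_def)
    have "(\<Sum>c\<in>A. (2 * snd c) powr s) \<le> (\<Sum>c\<in>A. (2 * \<delta>) powr s)"
    proof (rule sum_mono)
      fix c assume "c \<in> A"
      then have "c \<in> H" using split(5) by blast
      then show "(2 * snd c) powr s \<le> (2 * \<delta>) powr s"
        using r(1,2)[of c] s by (intro powr_mono2) auto
    qed
    also have "\<dots> = real (card (w ` A)) * (2 * \<delta>) powr s"
      using card_image[OF inj_on_subset[OF inj split(5)]] by simp
    also have "\<dots> \<le> real (card S) * (2 * \<delta>) powr s"
      using S by (intro mult_right_mono of_nat_mono card_mono) (auto simp: A_def S_def)
    finally have A: "(\<Sum>c\<in>A. (2 * snd c) powr s) \<le> e / 2"
      using \<delta>(1) by simp
    \<comment> \<open>A common bound on the word lengths, so that finitely many levels suffice and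
      the Cauchy estimate for \<open>T\<close> applies.\<close>
    define K where "K = Max (length ` w ` H \<union> {0})"
    have K: "length (w c) \<le> K" if "c \<in> H" for c
      unfolding K_def using that H(1) by (intro Max_ge) auto
    have "(\<Sum>c\<in>B. (2 * snd c) powr s) \<le> (\<Sum>c\<in>B. 2 powr s * m (butlast (w c)) powr s)"
    proof (rule sum_mono)
      fix c assume "c \<in> B"
      then have c: "c \<in> H" "w c \<noteq> []" by (auto simp: B_def)
      then have "p c \<in> dyadic_interval (butlast (w c))"
        using dyadic_interval_butlast[of "w c"] pw(3)[OF c(1)] by blast
      moreover have "\<not> length (w c) \<le> length (butlast (w c))"
        using c(2) by (cases "w c") auto
      ultimately have "\<not> m (butlast (w c)) \<le> snd c"
        using least[OF c(1)] by blast
      then show "(2 * snd c) powr s \<le> 2 powr s * m (butlast (w c)) powr s"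
        using s r(1)[OF c(1)] by (subst powr_mult[symmetric]) (auto intro!: powr_mono2)
    qed
    also have "\<dots> = 2 powr s * (\<Sum>v\<in>w ` B. m (butlast v) powr s)"
      by (subst sum.reindex[OF inj_on_subset[OF inj split(6)]]) (simp add: sum_distrib_left)
    also have "(\<Sum>v\<in>w ` B. m (butlast v) powr s)
        \<le> (\<Sum>v\<in>(\<Union>n\<in>{N..<K}. meeting_words F (Suc n)). m (butlast v) powr s)"
    proof (rule sum_mono2)
      show "w ` B \<subseteq> (\<Union>n\<in>{N..<K}. meeting_words F (Suc n))"
      proof
        fix v assume "v \<in> w ` B"
        then obtain c where c: "c \<in> H" "N < length v" "v = w c" by (auto simp: B_def)
        then have "length v \<le> K" "p c \<in> dyadic_interval v \<inter> F"
          using K pw by auto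
        then have "length v - 1 \<in> {N..<K}" "v \<in> meeting_words F (Suc (length v - 1))"
          using c(2) by (auto simp: meeting_words_def)
        then show "v \<in> (\<Union>n\<in>{N..<K}. meeting_words F (Suc n))" by blast
      qed
    qed auto
    also have "\<dots> = sum T {N..<K}"
      unfolding T_def by (rule sum.UNION_disjoint) (simp_all, auto simp: meeting_words_def)
    also have "\<dots> \<le> e'"
      using N[of K] by simp
    finally have "(\<Sum>c\<in>B. (2 * snd c) powr s) \<le> e / 2"
      by (simp add: e'_def)
    moreover have "(\<Sum>c\<in>H. (2 * snd c) powr s)
        = (\<Sum>c\<in>A. (2 * snd c) powr s) + (\<Sum>c\<in>B. (2 * snd c) powr s)"
      using split(2-4) by (subst split(1)) (rule sum.union_disjoint)
    ultimately show ?thesis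
      using A by (simp add: case_prod_unfold)
  qed
  then show "\<exists>\<delta>>0. \<forall>H. finite H \<and> ball_packing \<delta> (cascade_function \<mu> ` F) H \<longrightarrow>
      (\<Sum>(c, r)\<in>H. (2 * r) powr s) \<le> e"
    using \<delta>(2) by blast
qed

section \<open>Moments of the weight\<close>

text \<open>Young's inequality bounds the power by a convex combination of the variable and
  1.\<close>

lemma (in prob_space) integrable_powr_le_1:
  fixes W :: "'a \<Rightarrow> real"
  assumes "integrable M W" "AE \<omega> in M. W \<omega> > 0" "0 \<le> s" "s \<le> 1"
  shows "integrable M (\<lambda>\<omega>. W \<omega> powr s)"
proof (rule Bochner_Integration.integrable_bound)
  show "integrable M (\<lambda>\<omega>. 1 + W \<omega>)"
    using assms(1) by simp
  show "(\<lambda>\<omega>. W \<omega> powr s) \<in> borel_measurable M"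
    using borel_measurable_integrable[OF assms(1)] by measurable
  show "AE \<omega> in M. norm (W \<omega> powr s) \<le> norm (1 + W \<omega>)"
    using assms(2)
  proof eventually_elim
    case (elim \<omega>)
    have "W \<omega> powr s * 1 powr (1 - s) \<le> s * W \<omega> + (1 - s) * 1"
      using assms(3,4) elim by (intro Youngs_inequality_0) auto
    also have "\<dots> \<le> 1 * W \<omega> + 1 * 1"
      using assms(3,4) elim by (intro add_mono mult_right_mono) auto
    finally show ?case using elim by simp
  qed
qed

text \<open>This is Jensen's inequality for exp under the size-biased law with density
  \<open>W\<close>: there the moment is the mean of \<open>W powr (s - 1)\<close>, and the mean of
  \<open>ln W\<close> is \<open>K\<close>, which subcriticality keeps below \<open>ln 2\<close>. It
  is carried out with a tangent line, without changing the measure.\<close>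

lemma (in prob_space) moment_lower_bound:
  fixes W :: "'a \<Rightarrow> real"
  assumes W: "integrable M W" "expectation W = 1" "AE \<omega> in M. W \<omega> > 0"
    and ent: "integrable M (\<lambda>\<omega>. W \<omega> * log 2 (W \<omega>))" "expectation (\<lambda>\<omega>. W \<omega> * log 2 (W \<omega>)) < 1"
    and s: "0 \<le> s" "s < 1"
  shows "2 powr (s - 1) < expectation (\<lambda>\<omega>. W \<omega> powr s)"
proof -
  define K where "K = expectation (\<lambda>\<omega>. W \<omega> * log 2 (W \<omega>)) * ln 2"
  \<comment> \<open>The point of tangency: the size-biased mean of
    \<open>z = - (1 - s) * ln W\<close>. With this choice the tangent to exp at \<open>y\<close>,
    evaluated at \<open>z\<close>, has size-biased mean exactly \<open>exp y\<close>.\<close>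
  define y where "y = - (1 - s) * K"
  have lnK: "W \<omega> * log 2 (W \<omega>) * ln 2 = W \<omega> * ln (W \<omega>)" for \<omega>
    by (simp add: log_def)
  have int: "integrable M (\<lambda>\<omega>. W \<omega> * ln (W \<omega>))"
    using integrable_mult_left[OF ent(1), of "ln 2"] by (simp add: lnK)
  have K: "expectation (\<lambda>\<omega>. W \<omega> * ln (W \<omega>)) = K"
    unfolding K_def using integral_mult_left_zero[of M "\<lambda>\<omega>. W \<omega> * log 2 (W \<omega>)" "ln 2"]
    by (simp add: lnK)
  have "K < ln 2"
    unfolding K_def using ent(2) by simp
  then have "(1 - s) * K < (1 - s) * ln 2"
    using s by (intro mult_strict_left_mono) auto
  then have "2 powr (s - 1) < exp y"
    by (simp add: powr_def y_def algebra_simps)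
  also have "exp y = expectation (\<lambda>\<omega>. exp y * ((1 - y) * W \<omega> - (1 - s) * (W \<omega> * ln (W \<omega>))))"
  proof -
    have "expectation (\<lambda>\<omega>. exp y * ((1 - y) * W \<omega> - (1 - s) * (W \<omega> * ln (W \<omega>))))
        = exp y * ((1 - y) * expectation W - (1 - s) * expectation (\<lambda>\<omega>. W \<omega> * ln (W \<omega>)))"
      using W(1) int by simp
    also have "(1 - y) * expectation W - (1 - s) * expectation (\<lambda>\<omega>. W \<omega> * ln (W \<omega>)) = 1"
      unfolding W(2) K by (simp add: y_def algebra_simps)
    finally show ?thesis by simp
  qed
  also have "\<dots> \<le> expectation (\<lambda>\<omega>. W \<omega> powr s)"
  proof (rule integral_mono_AE)
    show "AE \<omega> in M. exp y * ((1 - y) * W \<omega> - (1 - s) * (W \<omega> * ln (W \<omega>))) \<le> W \<omega> powr s"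
      using W(3)
    proof eventually_elim
      case (elim \<omega>)
      define z where "z = - (1 - s) * ln (W \<omega>)"
      have "exp y * ((1 - y) * W \<omega> - (1 - s) * (W \<omega> * ln (W \<omega>))) = W \<omega> * (exp y * (1 + (z - y)))"
        by (simp add: z_def algebra_simps)
      also have "\<dots> \<le> W \<omega> * (exp y * exp (z - y))"
        using elim exp_ge_add_one_self[of "z - y"] by (intro mult_left_mono) auto
      also have "\<dots> = exp (ln (W \<omega>)) * exp z"
        using elim by (simp add: exp_diff)
      also have "\<dots> = W \<omega> powr s"
        using elim unfolding exp_add[symmetric] by (simp add: powr_def z_def algebra_simps)
      finally show ?case .
    qed
  qed (use W int s in \<open>auto intro!: integrable_powr_le_1\<close>)
  finally show ?thesis .
qed

lemma (in prob_space) moment_pos: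
  fixes W :: "'a \<Rightarrow> real"
  assumes "integrable M W" "AE \<omega> in M. W \<omega> > 0" "0 \<le> s" "s \<le> 1"
  shows "0 < expectation (\<lambda>\<omega>. W \<omega> powr s)"
proof -
  have "AE \<omega> in M. 0 < W \<omega> powr s"
    using assms(2) by eventually_elim simp
  then show ?thesis
    using integral_less_AE_space[of "\<lambda>_. 0" "\<lambda>\<omega>. W \<omega> powr s"] integrable_powr_le_1[OF assms]
    by (simp add: emeasure_space_1)
qed

text \<open>Interpolating the moment of order \<open>s'\<close> between those of order \<open>s\<close> and 1 by Young's inequality.\<close>

lemma (in prob_space) moment_interpolation:
  fixes W :: "'a \<Rightarrow> real"
  assumes W: "integrable M W" "expectation W = 1" "AE \<omega> in M. W \<omega> > 0"
    and s: "0 \<le> s" "s < 1" "0 \<le> \<theta>" "\<theta> \<le> 1"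
  shows "expectation (\<lambda>\<omega>. W \<omega> powr (\<theta> * s + (1 - \<theta>))) \<le> expectation (\<lambda>\<omega>. W \<omega> powr s) powr \<theta>"
proof -
  define a where "a = expectation (\<lambda>\<omega>. W \<omega> powr s)"
  have a: "a > 0"
    unfolding a_def using W s by (intro moment_pos) auto
  have "\<theta> * s \<le> \<theta> * 1"
    using s by (intro mult_left_mono) auto
  then have int: "integrable M (\<lambda>\<omega>. W \<omega> powr (\<theta> * s + (1 - \<theta>)))"
    using s W by (intro integrable_powr_le_1) auto
  have ints: "integrable M (\<lambda>\<omega>. W \<omega> powr s)"
    using s W by (intro integrable_powr_le_1) auto
  have "expectation (\<lambda>\<omega>. W \<omega> powr (\<theta> * s + (1 - \<theta>)))
      \<le> expectation (\<lambda>\<omega>. a powr \<theta> * (\<theta> / a * W \<omega> powr s + (1 - \<theta>) * W \<omega>))"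
  proof (rule integral_mono_AE[OF int])
    show "AE \<omega> in M. W \<omega> powr (\<theta> * s + (1 - \<theta>)) \<le> a powr \<theta> * (\<theta> / a * W \<omega> powr s + (1 - \<theta>) * W \<omega>)"
      using W(3)
    proof eventually_elim
      case (elim \<omega>)
      \<comment> \<open>Dividing by \<open>a\<close> gives both factors mean 1, so the right-hand
        side of Young's inequality integrates to exactly \<open>a powr \<theta>\<close>.\<close>
      have "W \<omega> powr (\<theta> * s + (1 - \<theta>)) = a powr \<theta> * ((W \<omega> powr s / a) powr \<theta> * W \<omega> powr (1 - \<theta>))"
        using a elim by (simp add: powr_divide powr_powr powr_add mult.commute)
      also have "\<dots> \<le> a powr \<theta> * (\<theta> * (W \<omega> powr s / a) + (1 - \<theta>) * W \<omega>)"
        using s a elim by (intro mult_left_mono Youngs_inequality_0) auto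
      finally show ?case by simp
    qed
  qed (use ints W in simp)
  also have "\<dots> = a powr \<theta> * (\<theta> / a * a + (1 - \<theta>) * 1)"
    using ints W by (simp add: a_def)
  also have "\<dots> = a powr \<theta>"
    using a by simp
  finally show ?thesis by (simp add: a_def)
qed

text \<open>Write s' as the combination of s and 1 with weight \<theta> on s. As the first moment is
  1, interpolation gives at most \<open>a powr \<theta>\<close> for the moment of order s'. The
  missing power \<open>a powr (1 - \<theta>)\<close> exceeds \<open>2 powr (s - s')\<close> by the
  lower bound, which is where strictness enters.\<close>

lemma (in prob_space) moment_ratio_strict_mono:
  fixes W :: "'a \<Rightarrow> real"
  assumes W: "integrable M W" "expectation W = 1" "AE \<omega> in M. W \<omega> > 0"
    and ent: "integrable M (\<lambda>\<omega>. W \<omega> * log 2 (W \<omega>))" "expectation (\<lambda>\<omega>. W \<omega> * log 2 (W \<omega>)) < 1"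
    and s: "0 \<le> s" "s < s'" "s' \<le> 1"
  shows "2 powr s / expectation (\<lambda>\<omega>. W \<omega> powr s) < 2 powr s' / expectation (\<lambda>\<omega>. W \<omega> powr s')"
proof -
  define a where "a = expectation (\<lambda>\<omega>. W \<omega> powr s)"
  define a' where "a' = expectation (\<lambda>\<omega>. W \<omega> powr s')"
  define \<theta> where "\<theta> = (1 - s') / (1 - s)"
  have \<theta>: "0 \<le> \<theta>" "\<theta> < 1" "\<theta> * (1 - s) = 1 - s'"
    using s by (auto simp: \<theta>_def)
  then have s': "\<theta> * s + (1 - \<theta>) = s'"
    by (simp add: algebra_simps)
  have exps: "(s - 1) * (1 - \<theta>) = s - s'"
    using \<theta>(3) by (simp add: algebra_simps)
  have pos: "0 < a" "0 < a'"
    unfolding a_def a'_def using W s by (auto intro!: moment_pos)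
  have "2 powr (s - 1) < a"
    unfolding a_def using W ent s by (intro moment_lower_bound) auto
  then have "(2 powr (s - 1)) powr (1 - \<theta>) < a powr (1 - \<theta>)"
    using \<theta> by (intro powr_less_mono2) auto
  then have "2 powr (s - s') < a powr (1 - \<theta>)"
    by (simp add: powr_powr exps)
  have "a' \<le> a powr \<theta>"
    using moment_interpolation[OF W, of s \<theta>] s \<theta> by (simp add: s' a_def a'_def)
  then have "2 powr s * a' \<le> 2 powr s' * (2 powr (s - s') * a powr \<theta>)"
    by (simp add: powr_diff)
  also have "\<dots> < 2 powr s' * (a powr (1 - \<theta>) * a powr \<theta>)"
    using \<open>2 powr (s - s') < a powr (1 - \<theta>)\<close> pos by (intro mult_strict_left_mono mult_strict_right_mono) auto
  also have "\<dots> = 2 powr s' * a"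
    using pos by (simp add: powr_add[symmetric])
  finally show ?thesis
    using pos by (simp add: a_def[symmetric] a'_def[symmetric] field_simps)
qed

section \<open>Moments of the cascade masses\<close>

locale cascade_weights = prob_space M for M :: "'a measure" +
  fixes W :: "'a \<Rightarrow> real" and Wi :: "bool list \<Rightarrow> 'a \<Rightarrow> real"
  assumes W_integrable: "integrable M W"
    and W_expectation: "expectation W = 1"
    and W_pos: "AE \<omega> in M. W \<omega> > 0"
    and Wi_indep: "indep_vars (\<lambda>_. borel) Wi {w. w \<noteq> []}"
    and Wi_distr: "\<And>w. w \<noteq> [] \<Longrightarrow> distr M borel (Wi w) = distr M borel W"
begin

lemma W_measurable [measurable]: "W \<in> borel_measurable M"
  using W_integrable by (rule borel_measurable_integrable)

lemma Wi_measurable: "w \<noteq> [] \<Longrightarrow> Wi w \<in> borel_measurable M"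
  using Wi_indep unfolding indep_vars_def by blast

lemma Wi_take_measurable [measurable]:
  "j \<in> {1..length w} \<Longrightarrow> Wi (take j w) \<in> borel_measurable M"
  by (rule Wi_measurable) auto

lemma Wi_append_take_measurable [measurable]:
  "j \<in> {1..length v} \<Longrightarrow> Wi (w @ take j v) \<in> borel_measurable M"
  by (rule Wi_measurable) auto

text \<open>Positivity depends only on the law, and there are countably many words, so one null set
  serves all of them.\<close>

lemma Wi_pos: "AE \<omega> in M. \<forall>w. w \<noteq> [] \<longrightarrow> Wi w \<omega> > 0"
proof -
  have "AE \<omega> in M. w \<noteq> [] \<longrightarrow> Wi w \<omega> > 0" for w
  proof (cases "w = []")
    case False
    have "AE x in distr M borel W. x > 0"
      using W_pos by (subst AE_distr_iff) auto
    then have "AE x in distr M borel (Wi w). x > 0"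
      unfolding Wi_distr[OF False] .
    then show ?thesis
      using Wi_measurable[OF False] by (subst (asm) AE_distr_iff) auto
  qed simp
  then show ?thesis by (simp add: AE_all_countable)
qed

text \<open>Prefixes of different lengths are different non-empty words, so their weights are
  independent. The function may vary with the level, so that the exponent can change along the
  branch.\<close>

lemma nn_integral_prod_prefix:
  assumes g: "\<And>j. g j \<in> borel_measurable borel"
  shows "(\<integral>\<^sup>+\<omega>. (\<Prod>j=1..length w. g j (Wi (take j w) \<omega>)) \<partial>M) = (\<Prod>j=1..length w. \<integral>\<^sup>+\<omega>. g j (W \<omega>) \<partial>M)"
proof -
  define I where "I = (\<lambda>j. take j w) ` {1..length w}"
  have inj: "inj_on (\<lambda>j. take j w) {1..length w}"
    by (rule inj_on_inverseI[of _ length]) auto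
  have I: "finite I" "I \<subseteq> {w. w \<noteq> []}"
    by (auto simp: I_def)
  have "indep_vars (\<lambda>_. borel) (\<lambda>u \<omega>. g (length u) (Wi u \<omega>)) I"
    by (rule indep_vars_compose2[OF indep_vars_subset[OF Wi_indep I(2)]]) (rule g)
  then have "(\<integral>\<^sup>+\<omega>. (\<Prod>u\<in>I. g (length u) (Wi u \<omega>)) \<partial>M) = (\<Prod>u\<in>I. \<integral>\<^sup>+\<omega>. g (length u) (Wi u \<omega>) \<partial>M)"
    by (intro indep_vars_nn_integral I(1)) auto
  moreover have "(\<integral>\<^sup>+\<omega>. g (length u) (Wi u \<omega>) \<partial>M) = (\<integral>\<^sup>+\<omega>. g (length u) (W \<omega>) \<partial>M)" if "u \<in> I" for u
  proof -
    have u: "u \<noteq> []" using that I(2) by auto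
    have "(\<integral>\<^sup>+\<omega>. g (length u) (Wi u \<omega>) \<partial>M) = (\<integral>\<^sup>+x. g (length u) x \<partial>distr M borel (Wi u))"
      using Wi_measurable[OF u] g by (subst nn_integral_distr) auto
    also have "\<dots> = (\<integral>\<^sup>+\<omega>. g (length u) (W \<omega>) \<partial>M)"
      using g by (subst Wi_distr[OF u], subst nn_integral_distr) auto
    finally show ?thesis .
  qed
  then have "(\<Prod>u\<in>I. \<integral>\<^sup>+\<omega>. g (length u) (Wi u \<omega>) \<partial>M) = (\<Prod>u\<in>I. \<integral>\<^sup>+\<omega>. g (length u) (W \<omega>) \<partial>M)"
    by (intro prod.cong) auto
  moreover have "(\<Prod>u\<in>I. h u) = (\<Prod>j=1..length w. h (take j w))" for h :: "bool list \<Rightarrow> ennreal"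
    unfolding I_def by (subst prod.reindex[OF inj]) simp
  moreover have "(\<Prod>j=1..length w. h (length (take j w))) = (\<Prod>j=1..length w. h j)" for h :: "nat \<Rightarrow> ennreal"
    by (intro prod.cong) auto
  ultimately show ?thesis
    by simp
qed

definition moment :: "real \<Rightarrow> real" where
  "moment s = expectation (\<lambda>\<omega>. W \<omega> powr s)"

lemma nn_integral_moment:
  assumes "0 \<le> s" "s \<le> 1"
  shows "(\<integral>\<^sup>+\<omega>. ennreal (W \<omega> powr s) \<partial>M) = ennreal (moment s)"
  unfolding moment_def using assms W_integrable W_pos
  by (intro nn_integral_eq_integral integrable_powr_le_1) auto

lemma nn_integral_W: "(\<integral>\<^sup>+\<omega>. ennreal (W \<omega>) \<partial>M) = 1"
proof -
  have "(\<integral>\<^sup>+\<omega>. ennreal (W \<omega>) \<partial>M) = ennreal (expectation W)"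
    using W_integrable W_pos by (intro nn_integral_eq_integral) (auto elim: eventually_mono)
  then show ?thesis by (simp add: W_expectation)
qed

lemma moment_nonneg: "0 \<le> moment s"
  by (simp add: moment_def)

lemma nn_integral_prefix_powr:
  assumes "0 \<le> s" "s \<le> 1"
  shows "(\<integral>\<^sup>+\<omega>. (\<Prod>j=1..length w. ennreal (Wi (take j w) \<omega> powr s)) \<partial>M) = ennreal (moment s) ^ length w"
  using nn_integral_prod_prefix[of "\<lambda>_ x. ennreal (x powr s)" w] nn_integral_moment[OF assms] by simp

text \<open>Both products run along the one branch \<open>w @ v\<close>: power s on the first part,
  power 1 afterwards, where each factor has mean 1.\<close>

lemma nn_integral_prefix_powr_times:
  assumes "0 \<le> s" "s \<le> 1"
  shows "(\<integral>\<^sup>+\<omega>. (\<Prod>j=1..length w. ennreal (Wi (take j w) \<omega> powr s)) *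
            (\<Prod>j=1..length v. ennreal (Wi (w @ take j v) \<omega>)) \<partial>M) = ennreal (moment s) ^ length w"
proof -
  have split: "(\<Prod>j=1..length (w @ v). h j) =
      (\<Prod>j=1..length w. h j) * (\<Prod>j=1..length v. h (length w + j))" for h :: "nat \<Rightarrow> ennreal"
  proof -
    have "(\<Prod>j=1..length (w @ v). h j)
        = (\<Prod>j=1..length w. h j) * (\<Prod>j=length w + 1..length w + length v. h j)"
      using prod.ub_add_nat[of 1 "length w" h "length v"] by simp
    also have "(\<Prod>j=length w + 1..length w + length v. h j) = (\<Prod>j=1..length v. h (length w + j))"
      using prod.shift_bounds_cl_nat_ivl[of h 1 "length w" "length v"] by (simp add: add.commute)
    finally show ?thesis .
  qed
  define g where "g j x = (if j \<le> length w then ennreal (x powr s) else ennreal x)" for j x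
  have "(\<integral>\<^sup>+\<omega>. (\<Prod>j=1..length (w @ v). g j (Wi (take j (w @ v)) \<omega>)) \<partial>M)
      = (\<Prod>j=1..length (w @ v). \<integral>\<^sup>+\<omega>. g j (W \<omega>) \<partial>M)"
    by (rule nn_integral_prod_prefix) (auto simp: g_def)
  also have "\<dots> = ennreal (moment s) ^ length w"
  proof -
    have "(\<Prod>j=1..length w. \<integral>\<^sup>+\<omega>. g j (W \<omega>) \<partial>M) = (\<Prod>j=1..length w. ennreal (moment s))"
      by (intro prod.cong) (auto simp: g_def nn_integral_moment[OF assms])
    moreover have "(\<Prod>j=1..length v. \<integral>\<^sup>+\<omega>. g (length w + j) (W \<omega>) \<partial>M) = (\<Prod>j=1..length v. 1)"
      by (intro prod.cong) (auto simp: g_def nn_integral_W)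
    ultimately show ?thesis
      unfolding split by simp
  qed
  also have "(\<integral>\<^sup>+\<omega>. (\<Prod>j=1..length (w @ v). g j (Wi (take j (w @ v)) \<omega>)) \<partial>M)
      = (\<integral>\<^sup>+\<omega>. (\<Prod>j=1..length w. ennreal (Wi (take j w) \<omega> powr s)) *
            (\<Prod>j=1..length v. ennreal (Wi (w @ take j v) \<omega>)) \<partial>M)"
    unfolding split
    by (intro nn_integral_cong arg_cong2[where f = "(*)"] prod.cong) (auto simp: g_def)
  finally show ?thesis .
qed

text \<open>The mass of the dyadic interval of \<open>w\<close> with its limit factor L replaced by
  the n-th partial sum. As a polynomial in finitely many weights it is measurable in
  \<omega>.\<close>

definition mass_approx :: "bool list \<Rightarrow> nat \<Rightarrow> 'a \<Rightarrow> real" where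
  "mass_approx w n \<omega> =
     1 / 2 ^ length w * (\<Prod>k=1..length w. Wi (take k w) \<omega>) * cascade_partial (\<lambda>w. Wi w \<omega>) w n"

lemma mass_approx_measurable [measurable]: "mass_approx w n \<in> borel_measurable M"
  unfolding mass_approx_def cascade_partial_def
  by (intro borel_measurable_times borel_measurable_const borel_measurable_prod borel_measurable_sum
      Wi_take_measurable Wi_append_take_measurable) auto

text \<open>Independence is only used for products along a single branch: \<open>y powr s \<le> 1 + y\<close> makes the
  bound linear in the partial sum, at the cost of the factor 2.\<close>

lemma nn_integral_mass_approx_powr:
  assumes s: "0 \<le> s" "s \<le> 1"
  shows "(\<integral>\<^sup>+\<omega>. ennreal (mass_approx w n \<omega> powr s) \<partial>M) \<le> ennreal (2 * ((1 / 2) powr s * moment s) ^ length w)"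
proof -
  define R where "R \<omega> = (\<Prod>j=1..length w. ennreal (Wi (take j w) \<omega> powr s))" for \<omega>
  define Q where "Q v \<omega> = (\<Prod>j=1..length v. ennreal (Wi (w @ take j v) \<omega>))" for v \<omega>
  define c where "c = ennreal (((1 / 2) powr s) ^ length w)"
  let ?V = "{v :: bool list. length v = n}"
  have [measurable]: "R \<in> borel_measurable M"
    unfolding R_def by (intro borel_measurable_prod_ennreal) auto
  have [measurable]: "Q v \<in> borel_measurable M" for v
    unfolding Q_def by (intro borel_measurable_prod_ennreal) auto
  have "AE \<omega> in M. ennreal (mass_approx w n \<omega> powr s)
      \<le> c * (R \<omega> + (\<Sum>v\<in>?V. ennreal (1 / 2 ^ n) * (R \<omega> * Q v \<omega>)))"
    using Wi_pos
  proof eventually_elim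
    case (elim \<omega>)
    define P where "P = cascade_partial (\<lambda>w. Wi w \<omega>) w n"
    have pos': "0 \<le> Wi (w @ take j v) \<omega>" if "j \<in> {1..length v}" for j v
      using elim[rule_format, of "w @ take j v"] that by fastforce
    have "P \<ge> 0"
      unfolding P_def cascade_partial_def
      by (intro sum_nonneg mult_nonneg_nonneg prod_nonneg) (auto intro!: pos')
    have P: "P powr s \<le> 1 + P"
    proof (cases "P = 0")
      case False
      then have "P powr s * 1 powr (1 - s) \<le> s * P + (1 - s) * 1"
        using s \<open>P \<ge> 0\<close> by (intro Youngs_inequality_0) auto
      also have "\<dots> \<le> 1 * P + 1 * 1"
        using s \<open>P \<ge> 0\<close> by (intro add_mono mult_right_mono) auto
      finally show ?thesis by simp
    qed simp
    have Psum: "ennreal P = (\<Sum>v\<in>?V. ennreal (1 / 2 ^ n) * Q v \<omega>)"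
    proof -
      have "ennreal P = (\<Sum>v\<in>?V. ennreal (1 / 2 ^ n * (\<Prod>k=1..n. Wi (w @ take k v) \<omega>)))"
        unfolding P_def cascade_partial_def
        by (intro sum_ennreal[symmetric] mult_nonneg_nonneg prod_nonneg) (auto intro!: pos')
      also have "\<dots> = (\<Sum>v\<in>?V. ennreal (1 / 2 ^ n) * Q v \<omega>)"
      proof (rule sum.cong)
        fix v assume "v \<in> ?V"
        then have v: "length v = n" by simp
        have "ennreal (\<Prod>k=1..n. Wi (w @ take k v) \<omega>) = Q v \<omega>"
          unfolding Q_def v using pos'[of _ v] v by (intro prod_ennreal[symmetric]) auto
        moreover have "0 \<le> (\<Prod>k=1..n. Wi (w @ take k v) \<omega>)"
          using pos'[of _ v] v by (intro prod_nonneg) auto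
        ultimately show "ennreal (1 / 2 ^ n * (\<Prod>k=1..n. Wi (w @ take k v) \<omega>)) = ennreal (1 / 2 ^ n) * Q v \<omega>"
          using ennreal_mult[of "1 / 2 ^ n" "\<Prod>k=1..n. Wi (w @ take k v) \<omega>"] by simp
      qed simp
      finally show ?thesis .
    qed
    have "mass_approx w n \<omega> powr s
        = ((1 / 2) powr s) ^ length w * (\<Prod>j=1..length w. Wi (take j w) \<omega> powr s) * P powr s"
    proof -
      have "(x ^ k) powr s = (x powr s) ^ k" for x :: real and k
        by (induction k) (simp_all add: powr_mult)
      from this[of "1 / 2" "length w"]
      have "(1 / 2 ^ length w) powr s = ((1 / 2 :: real) powr s) ^ length w"
        by (simp only: power_one_over)
      then show ?thesis
        by (simp only: mass_approx_def P_def powr_mult prod_powr_distrib)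
    qed
    also have "\<dots> \<le> ((1 / 2) powr s) ^ length w * (\<Prod>j=1..length w. Wi (take j w) \<omega> powr s) * (1 + P)"
      using P by (intro mult_left_mono mult_nonneg_nonneg prod_nonneg) auto
    finally have "ennreal (mass_approx w n \<omega> powr s)
        \<le> ennreal (((1 / 2) powr s) ^ length w * (\<Prod>j=1..length w. Wi (take j w) \<omega> powr s) * (1 + P))"
      by (rule ennreal_leI)
    also have "\<dots> = c * R \<omega> * (1 + ennreal P)"
      using \<open>P \<ge> 0\<close> by (simp add: c_def R_def ennreal_mult prod_nonneg prod_ennreal)
    also have "\<dots> = c * (R \<omega> + (\<Sum>v\<in>?V. ennreal (1 / 2 ^ n) * (R \<omega> * Q v \<omega>)))"
      unfolding Psum by (simp add: distrib_left sum_distrib_left mult_ac)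
    finally show ?case .
  qed
  then have "(\<integral>\<^sup>+\<omega>. ennreal (mass_approx w n \<omega> powr s) \<partial>M)
      \<le> (\<integral>\<^sup>+\<omega>. c * (R \<omega> + (\<Sum>v\<in>?V. ennreal (1 / 2 ^ n) * (R \<omega> * Q v \<omega>))) \<partial>M)"
    by (rule nn_integral_mono_AE)
  also have "\<dots> = c * ((\<integral>\<^sup>+\<omega>. R \<omega> \<partial>M) + (\<Sum>v\<in>?V. ennreal (1 / 2 ^ n) * (\<integral>\<^sup>+\<omega>. R \<omega> * Q v \<omega> \<partial>M)))"
    by (simp add: nn_integral_cmult nn_integral_add nn_integral_sum)
  also have "\<dots> = c * (ennreal (moment s) ^ length w + (\<Sum>v\<in>?V. ennreal (1 / 2 ^ n) * ennreal (moment s) ^ length w))"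
    unfolding R_def Q_def nn_integral_prefix_powr[OF s] nn_integral_prefix_powr_times[OF s] ..
  \<comment> \<open>The \<open>2 ^ n\<close> words carry weight \<open>1 / 2 ^ n\<close> each, so
    their terms average to one moment power. The resulting bound does not depend on n.\<close>
  also have "(\<Sum>v\<in>?V. ennreal (1 / 2 ^ n) * ennreal (moment s) ^ length w) = ennreal (moment s) ^ length w"
  proof -
    have "of_nat (card ?V) * ennreal (1 / 2 ^ n) = ennreal (real (card ?V) * (1 / 2 ^ n))"
      unfolding ennreal_of_nat_eq_real_of_nat by (intro ennreal_mult[symmetric]) auto
    also have "\<dots> = 1"
      by (simp add: card_words)
    finally show ?thesis
      by (simp only: sum_constant mult.assoc[symmetric] mult_1_left)
  qed
  also have "c * (ennreal (moment s) ^ length w + ennreal (moment s) ^ length w)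
      = ennreal (2 * ((1 / 2) powr s * moment s) ^ length w)"
  proof -
    define x where "x = ((1 / 2) powr s) ^ length w"
    define y where "y = moment s ^ length w"
    have xy: "0 \<le> x" "0 \<le> y"
      by (simp_all add: x_def y_def moment_nonneg)
    then have "ennreal x * (ennreal y + ennreal y) = ennreal (2 * (x * y))"
      by (simp add: ennreal_plus[symmetric] ennreal_mult[symmetric] mult_ac del: ennreal_plus)
    then show ?thesis
      by (simp add: c_def x_def y_def ennreal_power moment_nonneg power_mult_distrib)
  qed
  finally show ?thesis .
qed

text \<open>Fatou's lemma, applied to a bound that is uniform in n.\<close>

lemma nn_integral_liminf_mass_approx_powr:
  assumes s: "0 \<le> s" "s \<le> 1"
  shows "(\<integral>\<^sup>+\<omega>. liminf (\<lambda>n. ennreal (mass_approx w n \<omega> powr s)) \<partial>M)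
    \<le> ennreal (2 * ((1 / 2) powr s * moment s) ^ length w)"
proof -
  have "(\<integral>\<^sup>+\<omega>. liminf (\<lambda>n. ennreal (mass_approx w n \<omega> powr s)) \<partial>M)
      \<le> liminf (\<lambda>n. \<integral>\<^sup>+\<omega>. ennreal (mass_approx w n \<omega> powr s) \<partial>M)"
    by (intro nn_integral_liminf) measurable
  also have "\<dots> \<le> limsup (\<lambda>n. \<integral>\<^sup>+\<omega>. ennreal (mass_approx w n \<omega> powr s) \<partial>M)"
    by (intro Liminf_le_Limsup) simp
  also have "\<dots> \<le> ennreal (2 * ((1 / 2) powr s * moment s) ^ length w)"
    by (intro Limsup_bounded always_eventually allI nn_integral_mass_approx_powr s)
  finally show ?thesis .
qed

text \<open>Identifies the power of the true mass, realisation by realisation, with a liminf that is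
  measurable in \<omega> and has a controlled integral.\<close>

lemma measure_dyadic_powr_eq_liminf:
  assumes cascade: "is_cascade_measure (\<lambda>w. Wi w \<omega>) \<mu>" and s: "0 < s"
    and pos: "\<And>w. w \<noteq> [] \<Longrightarrow> Wi w \<omega> > 0"
  shows "ennreal (measure \<mu> (dyadic_interval w) powr s) = liminf (\<lambda>n. ennreal (mass_approx w n \<omega> powr s))"
proof -
  define P where "P = cascade_partial (\<lambda>w. Wi w \<omega>) w"
  define c where "c = 1 / 2 ^ length w * (\<Prod>k=1..length w. Wi (take k w) \<omega>)"
  have "c \<ge> 0"
    unfolding c_def by (intro mult_nonneg_nonneg prod_nonneg) (auto intro!: less_imp_le pos)
  have P: "P \<longlonglongrightarrow> lim P"
    using cascade unfolding P_def is_cascade_measure_def convergent_LIMSEQ_iff by blast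
  have Pn: "P n \<ge> 0" for n
    unfolding P_def cascade_partial_def
    by (intro sum_nonneg mult_nonneg_nonneg prod_nonneg) (auto intro!: less_imp_le pos)
  then have "lim P \<ge> 0"
    using P by (intro LIMSEQ_le_const) auto
  have "emeasure \<mu> (dyadic_interval w) = ennreal (c * lim P)"
    using cascade unfolding P_def c_def is_cascade_measure_def by blast
  then have "measure \<mu> (dyadic_interval w) = c * lim P"
    using \<open>c \<ge> 0\<close> \<open>lim P \<ge> 0\<close> by (simp add: measure_def)
  \<comment> \<open>The limit may be 0; s > 0 keeps the power continuous there.\<close>
  moreover have "(\<lambda>n. ennreal ((c * P n) powr s)) \<longlonglongrightarrow> ennreal ((c * lim P) powr s)"
    using P s \<open>c \<ge> 0\<close> Pn by (intro tendsto_ennrealI tendsto_powr' tendsto_intros) auto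
  then have "liminf (\<lambda>n. ennreal ((c * P n) powr s)) = ennreal ((c * lim P) powr s)"
    by (intro lim_imp_Liminf) auto
  ultimately show ?thesis
    by (simp add: mass_approx_def P_def c_def)
qed

lemma AE_summable_mass_powr:
  fixes F :: "real set"
  assumes cascade: "AE \<omega> in M. is_cascade_measure (\<lambda>w. Wi w \<omega>) (\<mu> \<omega>)"
    and s: "0 < s" "s \<le> 1" and t: "t \<ge> 0" "2 powr t * moment s < 2 powr s"
    and C: "C > 0" "\<And>n. real (card (meeting_words F (Suc n))) \<le> C * (2 powr t) ^ n"
  shows "AE \<omega> in M. summable (\<lambda>n. \<Sum>w\<in>meeting_words F (Suc n).
           measure (\<mu> \<omega>) (dyadic_interval (butlast w)) powr s)"
proof -
  define G where "G w \<omega> = liminf (\<lambda>n. ennreal (mass_approx w n \<omega> powr s))" for w \<omega>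
  have [measurable]: "G w \<in> borel_measurable M" for w
    unfolding G_def by measurable
  define p where "p = (1 / 2) powr s * moment s"
  \<comment> \<open>The ratio of the geometric series: \<open>2 powr t\<close> counts words per
    level and \<open>p\<close> is the moment factor per level. The words have length
    \<open>Suc n\<close> but their parents length n, so both factors occur to the power n.\<close>
  define q where "q = 2 powr t * p"
  have p: "p \<ge> 0"
    by (simp add: p_def moment_nonneg)
  have q: "0 \<le> q" "q < 1"
    using t(2) p by (simp_all add: q_def p_def powr_divide field_simps)
  have G: "(\<integral>\<^sup>+\<omega>. G w \<omega> \<partial>M) \<le> ennreal (2 * p ^ length w)" for w
    unfolding G_def p_def using s by (intro nn_integral_liminf_mass_approx_powr) auto
  have "(\<integral>\<^sup>+\<omega>. (\<Sum>n. \<Sum>w\<in>meeting_words F (Suc n). G (butlast w) \<omega>) \<partial>M)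
      = (\<Sum>n. \<Sum>w\<in>meeting_words F (Suc n). \<integral>\<^sup>+\<omega>. G (butlast w) \<omega> \<partial>M)"
    by (subst nn_integral_suminf) (auto simp: nn_integral_sum)
  also have "\<dots> \<le> (\<Sum>n. ennreal (2 * C * q ^ n))"
  proof (rule suminf_le)
    fix n
    have "(\<Sum>w\<in>meeting_words F (Suc n). \<integral>\<^sup>+\<omega>. G (butlast w) \<omega> \<partial>M)
        \<le> (\<Sum>w\<in>meeting_words F (Suc n). ennreal (2 * p ^ n))"
    proof (rule sum_mono)
      fix w assume "w \<in> meeting_words F (Suc n)"
      then have "length (butlast w) = n" by (simp add: meeting_words_def)
      then show "(\<integral>\<^sup>+\<omega>. G (butlast w) \<omega> \<partial>M) \<le> ennreal (2 * p ^ n)"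
        using G[of "butlast w"] by simp
    qed
    also have "\<dots> = ennreal (real (card (meeting_words F (Suc n))) * (2 * p ^ n))"
      using p by (simp add: ennreal_mult ennreal_of_nat_eq_real_of_nat)
    also have "\<dots> \<le> ennreal (C * (2 powr t) ^ n * (2 * p ^ n))"
      using p C(2)[of n] by (intro ennreal_leI mult_right_mono) auto
    also have "C * (2 powr t) ^ n * (2 * p ^ n) = 2 * C * q ^ n"
      by (simp add: q_def power_mult_distrib)
    finally show "(\<Sum>w\<in>meeting_words F (Suc n). \<integral>\<^sup>+\<omega>. G (butlast w) \<omega> \<partial>M) \<le> ennreal (2 * C * q ^ n)" .
  qed auto
  also have "\<dots> = ennreal (\<Sum>n. 2 * C * q ^ n)"
    using q C(1) by (intro suminf_ennreal2 summable_mult summable_geometric) auto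
  finally have "(\<integral>\<^sup>+\<omega>. (\<Sum>n. \<Sum>w\<in>meeting_words F (Suc n). G (butlast w) \<omega>) \<partial>M) \<noteq> \<infinity>"
    by (auto simp: top_unique)
  then have "AE \<omega> in M. (\<Sum>n. \<Sum>w\<in>meeting_words F (Suc n). G (butlast w) \<omega>) \<noteq> \<infinity>"
    by (intro nn_integral_noteq_infinite) measurable
  then show ?thesis
    using cascade Wi_pos
  proof eventually_elim
    case (elim \<omega>)
    have "G w \<omega> = ennreal (measure (\<mu> \<omega>) (dyadic_interval w) powr s)" for w
      unfolding G_def using elim s by (intro measure_dyadic_powr_eq_liminf[symmetric]) auto
    then have "(\<Sum>n. ennreal (\<Sum>w\<in>meeting_words F (Suc n).
        measure (\<mu> \<omega>) (dyadic_interval (butlast w)) powr s)) \<noteq> top"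
      using elim(1) by (simp add: sum_ennreal)
    then show ?case
      by (intro summable_suminf_not_top) (auto intro!: sum_nonneg)
  qed
qed

end

section \<open>The dimension bound\<close>

theorem corollary1p5:
  fixes M :: "'a measure"
    and W :: "'a \<Rightarrow> real"
    and Wi :: "bool list \<Rightarrow> 'a \<Rightarrow> real"
    and \<mu> :: "'a \<Rightarrow> real measure"
    and f :: "'a \<Rightarrow> real \<Rightarrow> real"
    and E :: "real set"
    and d\<^sub>E s :: real
  assumes "prob_space M"
    and "W \<in> borel_measurable M"
    and "AE \<omega> in M. W \<omega> > 0"
    and "\<not> (\<exists>c. AE \<omega> in M. W \<omega> = c)"
    and "integrable M W" and "(\<integral>\<omega>. W \<omega> \<partial>M) = 1"
    and "integrable M (\<lambda>\<omega>. W \<omega> * log 2 (W \<omega>))" and "(\<integral>\<omega>. W \<omega> * log 2 (W \<omega>) \<partial>M) < 1"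
    and "prob_space.indep_vars M (\<lambda>_. borel) Wi {w. w \<noteq> []}"
    and "\<And>w. w \<noteq> [] \<Longrightarrow> distr M borel (Wi w) = distr M borel W"
    and "AE \<omega> in M. is_cascade_measure (\<lambda>w. Wi w \<omega>) (\<mu> \<omega>)"
    and "\<And>\<omega>. f \<omega> = cascade_function (\<mu> \<omega>)"
    and "E \<noteq> {}" and "compact E" and "E \<subseteq> {0..1}"
    and "d\<^sub>E = real_of_ereal (packing_dim E)"
    and "0 \<le> s" and "s \<le> 1"
    and "2 powr d\<^sub>E = 2 powr s / (\<integral>\<omega>. W \<omega> powr s \<partial>M)"
  shows "AE \<omega> in M. packing_dim (f \<omega> ` E) \<le> ereal s"
proof -
  interpret cascade_weights M W Wi
    using assms(1,3,5,6,9,10) by (simp add: cascade_weights_def cascade_weights_axioms_def)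
  have pos: "\<And>r. 0 \<le> r \<Longrightarrow> r \<le> 1 \<Longrightarrow> 0 < moment r"
    unfolding moment_def using assms(3,5) by (intro moment_pos) auto
  \<comment> \<open>Covers s = 1, where no exponent s' with s < s' and s' \<le> 1 is left for the
    moment argument.\<close>
  have bounded: "AE \<omega> in M. packing_dim (f \<omega> ` E) \<le> 1"
    using assms(11)
  proof eventually_elim
    case (elim \<omega>)
    have "f \<omega> x \<in> {0..measure (\<mu> \<omega>) (space (\<mu> \<omega>))}" for x
      using finite_measure.bounded_measure[OF cascade_measure_finite[OF elim]]
      by (simp add: assms(12) cascade_function_def)
    then have "f \<omega> ` E \<subseteq> {0..measure (\<mu> \<omega>) (space (\<mu> \<omega>))}"
      by blast
    then have "bounded (f \<omega> ` E)"
      by (rule bounded_subset[OF bounded_closed_interval])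
    then show ?case by (rule packing_dim_bounded_real_le)
  qed
  have main: "AE \<omega> in M. packing_dim (f \<omega> ` E) \<le> ereal s'" if s': "s < s'" "s' \<le> 1" for s'
  proof -
    have "packing_dim E \<le> 1"
      using assms(14) by (intro packing_dim_bounded_real_le compact_imp_bounded)
    then have dE: "packing_dim E = ereal d\<^sub>E"
      using packing_dim_nonneg[of E] unfolding assms(16) by (cases "packing_dim E") auto
    have "2 powr d\<^sub>E < 2 powr s' / moment s'"
      unfolding assms(19) moment_def
      using assms(3,5-8,17) s' by (intro moment_ratio_strict_mono) auto
    \<comment> \<open>The strict inequality between the ratios at s and s' leaves room for an
      exponent t at which \<open>E\<close> is null and the geometric ratio stays below 1.\<close>
    then have "packing_dim E < ereal (log 2 (2 powr s' / moment s'))"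
      using pos[of s'] s' assms(17) unfolding dE by (simp add: less_log_iff)
    then obtain t where t: "0 \<le> t" "packing_measure t E = 0" "t < log 2 (2 powr s' / moment s')"
      unfolding packing_dim_def by (auto simp: INF_less_iff)
    then have growth: "2 powr t * moment s' < 2 powr s'"
      using pos[of s'] s' assms(17) by (simp add: less_log_iff field_simps)
    obtain F :: "nat \<Rightarrow> real set" where F: "E \<subseteq> (\<Union>i. F i)"
      "\<And>i. \<exists>\<delta>>0. \<forall>B. finite B \<and> ball_packing \<delta> (F i) B \<longrightarrow> (\<Sum>(x, r)\<in>B. (2 * r) powr t) < 1"
      using packing_measure_eq_0_cover[OF t(2)] by blast
    \<comment> \<open>The pieces of the cover need not lie in [0,1]. Intersecting them with
      \<open>E\<close> ensures this, and keeps the packing bound because packings of a subset are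
      packings of the piece.\<close>
    have "AE \<omega> in M. summable (\<lambda>n. \<Sum>w\<in>meeting_words (F i \<inter> E) (Suc n).
           measure (\<mu> \<omega>) (dyadic_interval (butlast w)) powr s')" for i
    proof -
      obtain \<delta> where \<delta>: "\<delta> > 0"
        "\<And>B. finite B \<Longrightarrow> ball_packing \<delta> (F i) B \<Longrightarrow> (\<Sum>(x, r)\<in>B. (2 * r) powr t) < 1"
        using F(2)[of i] by blast
      have "(\<Sum>(x, r)\<in>B. (2 * r) powr t) < 1" if "finite B" "ball_packing \<delta> (F i \<inter> E) B" for B
        using \<delta>(2)[of B] that by (auto simp: ball_packing_def)
      then obtain C where "C > 0"
        "\<And>n. real (card (meeting_words (F i \<inter> E) (Suc n))) \<le> C * (2 powr t) ^ n"
        using card_meeting_words_growth[of \<delta> t "F i \<inter> E"] \<delta>(1) t(1) by blast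
      then show ?thesis
        using assms(11,17) s' t(1) growth by (intro AE_summable_mass_powr) auto
    qed
    then have "AE \<omega> in M. \<forall>i. summable (\<lambda>n. \<Sum>w\<in>meeting_words (F i \<inter> E) (Suc n).
           measure (\<mu> \<omega>) (dyadic_interval (butlast w)) powr s')"
      by (simp add: AE_all_countable)
    then show ?thesis
      using assms(11)
    proof eventually_elim
      case (elim \<omega>)
      have "packing_measure s' (f \<omega> ` E) = 0"
      proof (rule packing_measure_eq_0I)
        show "f \<omega> ` E \<subseteq> (\<Union>i. f \<omega> ` (F i \<inter> E))"
          using F(1) by blast
        show "packing_premeasure s' (f \<omega> ` (F i \<inter> E)) = 0" for i
          unfolding assms(12) using elim assms(15,17) s'
          by (intro packing_premeasure_cascade_image) auto
      qed
      then show ?case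
        using assms(17) s' by (intro packing_dim_le) auto
    qed
  qed
  show ?thesis
  proof (cases "s = 1")
    case True
    then show ?thesis using bounded by (simp add: one_ereal_def)
  next
    case False
    \<comment> \<open>A sequence in (s,1] with limit s, so that the null sets of the exponents
      combine to a single one.\<close>
    define u where "u n = s + (1 - s) / real (Suc n)" for n
    have "s < u n" "u n \<le> 1" for n
    proof -
      have "(1 - s) / real (Suc n) \<le> (1 - s) / 1"
        using assms(18) by (intro divide_left_mono) auto
      then show "u n \<le> 1" by (simp add: u_def)
      show "s < u n" using False assms(18) by (simp add: u_def)
    qed
    then have "AE \<omega> in M. \<forall>n. packing_dim (f \<omega> ` E) \<le> ereal (u n)"
      using main by (simp add: AE_all_countable)
    moreover have "(\<lambda>n. (1 - s) / real (Suc n)) \<longlonglongrightarrow> 0"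
      by (rule LIMSEQ_Suc[OF lim_const_over_n])
    then have "u \<longlonglongrightarrow> s + 0"
      unfolding u_def by (intro tendsto_intros)
    then have "(\<lambda>n. ereal (u n)) \<longlonglongrightarrow> ereal s"
      by simp
    ultimately show ?thesis
      by (auto elim!: eventually_mono intro: LIMSEQ_le_const)
  qed
qed

end
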